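(* Let $n\ge2$ and $\nu\in X^+_{2n-1,0}$. The assignment $T\mapsto T\downarrow^{D\mathrm{II}_n}_{D_{n-1}}$ gives rise to a bijection $$\mathsf{KNT}^{D\mathrm{II}_n}(\nu)\to\bigsqcup_{\mu}\mathsf{KNT}^{D_{n-1}}(\mu),$$ where $\mu$ runs over all $\mu\in X^+_{2n-2,0}$ such that $\mathsf{par}(\mu)\subseteq\mathsf{par}(\nu)$ and $\mathsf{par}(\nu)/\mathsf{par}(\mu)$ is a horizontal strip.
   Context: **Weights.** For $m\ge1$: $X^+_{2m,0}=\{\lambda\in\mathbb Z^m\mid\lambda_1\ge\cdots\ge\lambda_{m-1}\ge|\lambda_m|\}$ and $X^+_{2m+1,0}=\{\lambda\in\mathbb Z^m\mid\lambda_1\ge\cdots\ge\lambda_m\ge0\}$. $\mathsf{par}(\lambda)=(\lambda_1,\dots,\lambda_{m-1},|\lambda_m|)$, a partition. For $\lambda\in X^+_{2m,0}$, $\mathsf e(\lambda)\in\{+,-,0\}$ is the sign of $\lambda_m$. $\nu\in X^+_{2m-1,0}$ is identified with $(\nu_1,\dots,\nu_{m-1},0)\in X^+_{2m,0}$. $\lambda/\mu$ is a horizontal strip (with $\mu\subseteq\lambda$) iff $\lambda_1\ge\mu_1\ge\lambda_2\ge\mu_2\ge\cdots$. **Columns of type $D_m$** ($m\ge1$). Let $\mathcal A^{D_m}=\{1,\dots,m,\overline m,\dots,\overline 1\}$ be partially ordered by $1\prec\cdots\prec m-1$, $m-1\prec m\prec\overline{m-1}$, $m-1\prec\overline m\prec\overline{m-1}$,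 $\overline{m-1}\prec\cdots\prec\overline 1$ ($m,\overline m$ incomparable). $|a|=|\overline a|=a$ for $1\le a\le m$. Words are written $\mathbf a=(a_l,\dots,a_1)$ with length $|\mathbf a|=l$. $\mathbf a_{\le b}$ (resp. $\mathbf a_{>b}$) is the subword of letters $c$ with $|c|\le b$ (resp. $>b$). $\mathsf O(\mathbf a)$ is the set of $b\in\{1,\dots,m\}$ with both $b,\overline b$ occurring in $\mathbf a$. $\mathbf a$ is quasi-increasing if for each $r$ either $a_r\prec a_{r+1}$ or $(a_r,a_{r+1})\in\{(m,\overline m),(\overline m,m)\}$. Its sign $\mathsf e(\mathbf a)$ is $+$ if $a_r=m$ for some $r\equiv m\pmod 2$ or $a_r=\overline m$ for some $r\not\equiv m$; $-$ if $a_r=m$ for some $r\not\equiv m$ or $a_r=\overline m$ for some $r\equiv m$; $0$ if neither $m$ nor $\overline m$ occurs. A KN column of type $D_m$ is a quasi-increasing word with $|\mathbf a|\le m$ and $|\mathbf a_{\le b}|\le b$ for all $b\in\mathsf O(\mathbf a)$. It is of type $D\mathrm{II}_m$ if moreover $|\mathbf a|<m$, the letter $1$ does not occur in $\mathbf a$, and $|(\mathbf a_{>1})_{\le b}|<b$ for all $b\in\mathsf O(\mathbf a)$. **Adjacency (type $D_m$).** For KN columns $\mathbf a=(a_k,\dots,a_1)$, $\mathbf b=(b_l,\dots,b_1)$ write $\mathbf a\triangleleft\mathbf b$ if: (i) $k\ge l>0$; (ii) $a_r\preceq b_r$ for $1\le r\le l$; (iii) whenever $1\le a\le b\le m-1$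 and $1\le r\le s<t\le u\le l$ satisfy $a_r=a$, $b_u=\overline a$ and ($(b_s,b_t)=(b,\overline b)$ or $(a_s,a_t)=(b,\overline b)$), then $(s-r)+(u-t)<b-a$; (iv) whenever $1\le a\le m-1$ and $1\le r<s<u\le l$ satisfy $a_r=a$, $b_u=\overline a$ and at least one of $(b_s,b_{s+1})$, $(a_s,a_{s+1})$ lies in $\{(m,\overline m),(\overline m,m)\}$, then $u-r-1<m-a$; (v) there are no $1\le s<t\le l$ with $a_s\in\{m,\overline m\}$ and $b_t\in\{m,\overline m\}$; (vi) whenever $1\le a\le m-1$ and $1\le r\le s<t\le u\le l$ satisfy $t-s+1$ odd, $a_r=a$, $b_u=\overline a$, $(b_s,a_t)\in\{(m,\overline m),(\overline m,m)\}$, then $u-r<m-a$; (vii) whenever $1\le a\le m-1$ and $1\le r\le s<t\le u\le l$ satisfy $t-s+1$ even, $a_r=a$, $b_u=\overline a$, $(b_s,a_t)\in\{(m,m),(\overline m,\overline m)\}$, then $u-r<m-a$. **Tableaux.** For $\lambda\in X^+_{2m,0}$, $\mathsf{KNT}^{D_m}(\lambda)$ is the set of sequences $T=(\mathbf a^1,\dots,\mathbf a^p)$ of KN columns of type $D_m$ with $\mathbf a^1\triangleleft\cdots\triangleleft\mathbf a^p$, $(|\mathbf a^1|,\dots,|\mathbf a^p|)$ equal to the conjugate partition of $\mathsf{par}(\lambda)$, and $\mathsf e(\mathbf a^r)=\mathsf e(\lambda)$ whenever $|\mathbf a^r|=m$. For $\nu\in X^+_{2m-1,0}$, $\mathsf{KNT}^{D\mathrm{II}_m}(\nu)$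 is the set of $T\in\mathsf{KNT}^{D_m}(\nu)$ whose first column $\mathbf a^1$ is of type $D\mathrm{II}_m$ (the empty tableau is included for $\nu=0$). **Reduction.** For $T=(\mathbf a^1,\dots,\mathbf a^p)\in\mathsf{KNT}^{D\mathrm{II}_n}(\nu)$ (all of whose columns are then of type $D\mathrm{II}_n$), $T\downarrow^{D\mathrm{II}_n}_{D_{n-1}}$ is obtained by replacing each column $\mathbf a^r$ by the word obtained from it by deleting the letter $\overline 1$ (if present) and replacing the letters $2,\dots,n,\overline n,\dots,\overline2$ by $1,\dots,n-1,\overline{n-1},\dots,\overline1$ respectively; columns that become empty are discarded. *)

theory Defs
  imports Main "HOL-Library.More_List" "HOL-Library.Disjoint_Sets"
begin

section \<open>Weights\<close>

text \<open>Weights are integer lists \<open>[\<kappa>\<^sub>1, \<dots>, \<kappa>\<^sub>m]\<close>. In \<open>par\<close> only the last entry can be negative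
  for the weights considered here.\<close>

definition par :: "int list \<Rightarrow> int list" where
  "par \<kappa> = butlast \<kappa> @ [\<bar>last \<kappa>\<bar>]"

text \<open>\<open>X_even m\<close> is $X^+_{2m,0}$ (for \<open>m \<ge> 1\<close>); the chain
  \<open>\<kappa>\<^sub>1 \<ge> \<dots> \<ge> \<kappa>\<^sub>m\<^sub>-\<^sub>1 \<ge> \<bar>\<kappa>\<^sub>m\<bar>\<close> says precisely that the list \<open>par \<kappa>\<close> is weakly decreasing.
  \<open>X_odd m\<close> is $X^+_{2m+1,0}$.\<close>

definition X_even :: "nat \<Rightarrow> int list set" where
  "X_even m = {\<kappa>. length \<kappa> = m \<and> sorted_wrt (\<ge>) (par \<kappa>)}"

definition X_odd :: "nat \<Rightarrow> int list set" where
  "X_odd m = {\<kappa>. length \<kappa> = m \<and> sorted_wrt (\<ge>) (\<kappa> @ [0])}"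

definition embed_odd :: "int list \<Rightarrow> int list" where
  "embed_odd \<nu> = \<nu> @ [0]"

text \<open>The sign \<open>+\<close>, \<open>-\<close>, \<open>0\<close> is rendered as the integer \<open>1\<close>, \<open>-1\<close>, \<open>0\<close>.\<close>

definition weight_sign :: "int list \<Rightarrow> int" where
  "weight_sign \<kappa> = sgn (last \<kappa>)"

text \<open>Partitions are compared after padding with zeros: \<open>nth_default 0 p i\<close> is the part with
  (1-based) number \<open>i + 1\<close>.\<close>

definition part_subset :: "int list \<Rightarrow> int list \<Rightarrow> bool" where
  "part_subset p q \<longleftrightarrow> (\<forall>i. nth_default 0 p i \<le> nth_default 0 q i)"

definition horizontal_strip :: "int list \<Rightarrow> int list \<Rightarrow> bool" where
  "horizontal_strip q p \<longleftrightarrow>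
     (\<forall>i. nth_default 0 q i \<ge> nth_default 0 p i \<and> nth_default 0 p i \<ge> nth_default 0 q (Suc i))"

text \<open>The nonzero parts of the conjugate of the partition \<open>p\<close>; there are \<open>p\<^sub>1\<close> of them.\<close>

definition conj_part :: "int list \<Rightarrow> nat list" where
  "conj_part p = map (\<lambda>j. card {i. i < length p \<and> int j \<le> p ! i}) [1..<Suc (nat (hd p))]"


section \<open>Letters and words\<close>

datatype letter = Unbar nat | Bar nat

primrec letter_abs :: "letter \<Rightarrow> nat" where
  "letter_abs (Unbar a) = a"
| "letter_abs (Bar a) = a"

definition alphabet :: "nat \<Rightarrow> letter set" where
  "alphabet m = Unbar ` {1..m} \<union> Bar ` {1..m}"

text \<open>The strict partial order of type \<open>D\<^sub>m\<close>: every unbarred letter is below every barred one,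
  except that \<open>Unbar m\<close> and \<open>Bar m\<close> are incomparable.\<close>

fun prec :: "nat \<Rightarrow> letter \<Rightarrow> letter \<Rightarrow> bool" where
  "prec m (Unbar a) (Unbar b) \<longleftrightarrow> a < b"
| "prec m (Unbar a) (Bar b) \<longleftrightarrow> \<not> (a = m \<and> b = m)"
| "prec m (Bar a) (Unbar b) \<longleftrightarrow> False"
| "prec m (Bar a) (Bar b) \<longleftrightarrow> b < a"

definition preceq :: "nat \<Rightarrow> letter \<Rightarrow> letter \<Rightarrow> bool" where
  "preceq m x y \<longleftrightarrow> x = y \<or> prec m x y"

definition mixed_pairs :: "nat \<Rightarrow> (letter \<times> letter) set" where
  "mixed_pairs m = {(Unbar m, Bar m), (Bar m, Unbar m)}"

definition same_pairs :: "nat \<Rightarrow> (letter \<times> letter) set" where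
  "same_pairs m = {(Unbar m, Unbar m), (Bar m, Bar m)}"

text \<open>A word \<open>(a\<^sub>l, \<dots>, a\<^sub>1)\<close> is stored as the list \<open>[a\<^sub>1, \<dots>, a\<^sub>l]\<close>, so that the index of a
  letter counts from the head; \<open>ltr a r\<close> is \<open>a\<^sub>r\<close>, meaningful for \<open>1 \<le> r \<le> length a\<close> only.\<close>

type_synonym word = "letter list"

definition ltr :: "word \<Rightarrow> nat \<Rightarrow> letter" where
  "ltr a r = a ! (r - 1)"

definition sub_le :: "nat \<Rightarrow> word \<Rightarrow> word" where
  "sub_le b a = filter (\<lambda>c. letter_abs c \<le> b) a"

definition sub_gt :: "nat \<Rightarrow> word \<Rightarrow> word" where
  "sub_gt b a = filter (\<lambda>c. letter_abs c > b) a"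

definition both_signs :: "nat \<Rightarrow> word \<Rightarrow> nat set" where
  "both_signs m a = {b \<in> {1..m}. Unbar b \<in> set a \<and> Bar b \<in> set a}"

definition quasi_increasing :: "nat \<Rightarrow> word \<Rightarrow> bool" where
  "quasi_increasing m a \<longleftrightarrow>
     (\<forall>r. 1 \<le> r \<and> r < length a \<longrightarrow>
        prec m (ltr a r) (ltr a (r + 1)) \<or> (ltr a r, ltr a (r + 1)) \<in> mixed_pairs m)"

text \<open>In a quasi-increasing word the letters \<open>m\<close> and its barred version occupy consecutive
  positions and alternate, so at most one of the first two cases applies.\<close>

definition word_sign :: "nat \<Rightarrow> word \<Rightarrow> int" where
  "word_sign m a =
     (if \<exists>r\<in>{1..length a}. (ltr a r = Unbar m \<and> r mod 2 = m mod 2) \<or>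
                             (ltr a r = Bar m \<and> r mod 2 \<noteq> m mod 2) then 1
      else if \<exists>r\<in>{1..length a}. (ltr a r = Unbar m \<and> r mod 2 \<noteq> m mod 2) \<or>
                                  (ltr a r = Bar m \<and> r mod 2 = m mod 2) then -1
      else 0)"


section \<open>Kashiwara-Nakashima columns\<close>

definition KN_column :: "nat \<Rightarrow> word \<Rightarrow> bool" where
  "KN_column m a \<longleftrightarrow>
     set a \<subseteq> alphabet m \<and> quasi_increasing m a \<and> length a \<le> m \<and>
     (\<forall>b\<in>both_signs m a. length (sub_le b a) \<le> b)"

definition DII_column :: "nat \<Rightarrow> word \<Rightarrow> bool" where
  "DII_column m a \<longleftrightarrow>
     KN_column m a \<and> length a < m \<and> Unbar 1 \<notin> set a \<and>
     (\<forall>b\<in>both_signs m a. length (sub_le b (sub_gt 1 a)) < b)"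

text \<open>The columns are \<open>a = (a\<^sub>k, \<dots>, a\<^sub>1)\<close> and \<open>b = (b\<^sub>l, \<dots>, b\<^sub>1)\<close>, and \<open>x\<close>, \<open>y\<close> are numbers of letters.
  For \<open>m \<ge> 1\<close> all natural number subtractions are exact, thanks to the inequalities assumed in
  each condition.\<close>

definition adjacent :: "nat \<Rightarrow> word \<Rightarrow> word \<Rightarrow> bool" where
  "adjacent m a b \<longleftrightarrow>
     length a \<ge> length b \<and> length b > 0 \<and>
     (\<forall>r. 1 \<le> r \<and> r \<le> length b \<longrightarrow> preceq m (ltr a r) (ltr b r)) \<and>
     (\<forall>x y r s t u.
        1 \<le> x \<and> x \<le> y \<and> y \<le> m - 1 \<and>
        1 \<le> r \<and> r \<le> s \<and> s < t \<and> t \<le> u \<and> u \<le> length b \<and>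
        ltr a r = Unbar x \<and> ltr b u = Bar x \<and>
        ((ltr b s, ltr b t) = (Unbar y, Bar y) \<or> (ltr a s, ltr a t) = (Unbar y, Bar y)) \<longrightarrow>
        (s - r) + (u - t) < y - x) \<and>
     (\<forall>x r s u.
        1 \<le> x \<and> x \<le> m - 1 \<and>
        1 \<le> r \<and> r < s \<and> s < u \<and> u \<le> length b \<and>
        ltr a r = Unbar x \<and> ltr b u = Bar x \<and>
        ((ltr b s, ltr b (s + 1)) \<in> mixed_pairs m \<or> (ltr a s, ltr a (s + 1)) \<in> mixed_pairs m) \<longrightarrow>
        u - r - 1 < m - x) \<and>
     (\<nexists>s t.
        1 \<le> s \<and> s < t \<and> t \<le> length b \<and>
        ltr a s \<in> {Unbar m, Bar m} \<and> ltr b t \<in> {Unbar m, Bar m}) \<and>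
     (\<forall>x r s t u.
        1 \<le> x \<and> x \<le> m - 1 \<and>
        1 \<le> r \<and> r \<le> s \<and> s < t \<and> t \<le> u \<and> u \<le> length b \<and>
        odd (t - s + 1) \<and> ltr a r = Unbar x \<and> ltr b u = Bar x \<and>
        (ltr b s, ltr a t) \<in> mixed_pairs m \<longrightarrow>
        u - r < m - x) \<and>
     (\<forall>x r s t u.
        1 \<le> x \<and> x \<le> m - 1 \<and>
        1 \<le> r \<and> r \<le> s \<and> s < t \<and> t \<le> u \<and> u \<le> length b \<and>
        even (t - s + 1) \<and> ltr a r = Unbar x \<and> ltr b u = Bar x \<and>
        (ltr b s, ltr a t) \<in> same_pairs m \<longrightarrow>
        u - r < m - x)"


section \<open>Tableaux and reduction\<close>

type_synonym tableau = "word list"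

definition KNT :: "nat \<Rightarrow> int list \<Rightarrow> tableau set" where
  "KNT m \<kappa> =
     {T. (\<forall>a\<in>set T. KN_column m a) \<and>
         successively (adjacent m) T \<and>
         map length T = conj_part (par \<kappa>) \<and>
         (\<forall>a\<in>set T. length a = m \<longrightarrow> word_sign m a = weight_sign \<kappa>)}"

definition KNT_DII :: "nat \<Rightarrow> int list \<Rightarrow> tableau set" where
  "KNT_DII m \<nu> = {T \<in> KNT m (embed_odd \<nu>). T \<noteq> [] \<longrightarrow> DII_column m (hd T)}"

text \<open>The letter \<open>Unbar 1\<close> does not occur in the columns to which the reduction is applied.\<close>

primrec lower_letter :: "letter \<Rightarrow> letter" where
  "lower_letter (Unbar a) = Unbar (a - 1)"
| "lower_letter (Bar a) = Bar (a - 1)"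

definition reduce_column :: "word \<Rightarrow> word" where
  "reduce_column a = map lower_letter (filter (\<lambda>x. x \<noteq> Bar 1) a)"

definition reduce :: "tableau \<Rightarrow> tableau" where
  "reduce T = filter (\<lambda>a. a \<noteq> []) (map reduce_column T)"

definition strip_weights :: "nat \<Rightarrow> int list \<Rightarrow> int list set" where
  "strip_weights n \<nu> =
     {\<mu> \<in> X_even (n - 1).
        part_subset (par \<mu>) (par (embed_odd \<nu>)) \<and>
        horizontal_strip (par (embed_odd \<nu>)) (par \<mu>)}"

end

theory Submission
  imports Defs
begin

text \<open>Put \<open>m = n - 1\<close>. A column of type DII for \<open>n\<close> has no letter \<open>1\<close>, and the letter \<open>Bar 1\<close>,
  being the largest, can only stand at its end. Hence it is a word \<open>w\<close> over the alphabet for \<open>m\<close>,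
  raised by one, with \<open>Bar 1\<close> possibly appended: in symbols \<open>raise_column c w\<close>. The theorem holds
  because the defining conditions hardly notice the appended letter. For one column, the bound in
  the DII condition is the KN condition for \<open>w\<close> (lemma \<open>DII_raise_column_iff\<close>). For two adjacent
  columns, all conditions except the comparison of rows and the comparison of lengths concern
  either a pair \<open>Unbar x\<close>, \<open>Bar x\<close> of letters or the letters \<open>Unbar n\<close>, \<open>Bar n\<close>; since
  \<open>Unbar 1\<close> is absent they never involve \<open>Bar 1\<close>, so that these conditions are merely shifted by
  one. The comparison of rows says in addition that nothing but
  \<open>Bar 1\<close> stands to the right of \<open>Bar 1\<close>, i.e. that the reduced columns still weakly decrease in
  length (lemma \<open>adjacent_raise_column_iff\<close>). A tableau of shape \<open>\<nu>\<close> all of whose columns are of type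
  DII is therefore the same thing as a sequence of adjacent KN columns for \<open>m\<close> whose lengths fall
  short of those prescribed by \<open>\<nu>\<close> by at most one, and the places of the letters \<open>Bar 1\<close> can be read
  off from the lengths (lemma \<open>bij_betw_reduce\<close>). That column lengths differ by at most one means that
  the shapes differ by a horizontal strip (lemma \<open>horizontal_strip_iff_conj_part\<close>).

  Two facts about adjacent columns are left. Only the first column of a tableau is assumed to be of
  type DII, so the property has to pass to the right (lemma \<open>DII_column_adjacent\<close>). And the sequence
  obtained by reduction has to belong to some weight \<open>\<mu>\<close>, for which all its columns of length \<open>m\<close>
  must have the same nonzero sign (lemma \<open>full_columns_same_sign\<close>). Both are proved by the same
  count. If the assertion fails for \<open>a\<close> and \<open>b\<close>, then a set \<open>A\<close> of \<open>x\<close> with \<open>Unbar x\<close> in \<open>a\<close> and a set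
  \<open>B\<close> of \<open>x\<close> with \<open>Bar x\<close> in \<open>b\<close> are together too large to be disjoint. Their least common element \<open>x\<close>
  has few elements of \<open>A\<close> and \<open>B\<close> below it, hence many above it; so \<open>x\<close> and \<open>Bar x\<close> are
  farther apart than the adjacency conditions permit.\<close>

section \<open>The least common element of two large sets\<close>

text \<open>The sets overlap, being too large to be disjoint. Below their least common element \<open>x\<close> they are
  disjoint, so they share the \<open>x - c\<close> numbers up to \<open>x\<close> and count only \<open>x\<close> itself twice.\<close>

lemma least_common_element:
  fixes A B :: "nat set"
  assumes A: "A \<subseteq> {Suc c..N}" and B: "B \<subseteq> {Suc c..N}" and card: "N - c < card A + card B"
  obtains x where "x \<in> A" "x \<in> B" "card {z \<in> A. z \<le> x} + card {z \<in> B. z \<le> x} \<le> Suc (x - c)"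
proof -
  have fin: "finite A" "finite B"
    using A B finite_subset by blast+
  have "A \<inter> B \<noteq> {}"
  proof
    assume "A \<inter> B = {}"
    then have "card A + card B = card (A \<union> B)"
      using fin by (simp add: card_Un_disjoint)
    also have "\<dots> \<le> card {Suc c..N}"
      using A B by (intro card_mono) auto
    finally show False
      using card by simp
  qed
  define x where "x = Min (A \<inter> B)"
  have x: "x \<in> A" "x \<in> B" and min: "\<And>z. z \<in> A \<Longrightarrow> z \<in> B \<Longrightarrow> x \<le> z"
    using Min_in[of "A \<inter> B"] Min_le[of "A \<inter> B"] fin \<open>A \<inter> B \<noteq> {}\<close> by (auto simp: x_def)
  let ?A = "{z \<in> A. z \<le> x}" and ?B = "{z \<in> B. z \<le> x}"
  have "card ?A + card ?B = card (?A \<union> ?B) + card (?A \<inter> ?B)"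
    using fin by (intro card_Un_Int) auto
  also have "?A \<inter> ?B = {x}"
    using x min by (auto intro: antisym)
  also have "card (?A \<union> ?B) \<le> card {Suc c..x}"
    using A B by (intro card_mono) auto
  finally show ?thesis
    using x that by simp
qed

section \<open>Quasi-increasing words\<close>

text \<open>On the alphabet for \<open>m\<close>, the order \<open>prec m\<close> is the order of the ranks (lemma \<open>prec_iff_rank\<close>): both
  incomparable letters \<open>Unbar m\<close> and \<open>Bar m\<close> get rank \<open>m\<close>, and every other letter has a rank of its own.\<close>

primrec rank :: "nat \<Rightarrow> letter \<Rightarrow> nat" where
  "rank m (Unbar a) = a"
| "rank m (Bar a) = 2 * m - a"

text \<open>The relation between consecutive letters of a quasi-increasing word.\<close>

definition qless :: "nat \<Rightarrow> letter \<Rightarrow> letter \<Rightarrow> bool" where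
  "qless m x y \<longleftrightarrow> prec m x y \<or> (x, y) \<in> mixed_pairs m"

lemma quasi_increasing_iff: "quasi_increasing m a \<longleftrightarrow> successively (qless m) a"
proof
  assume q: "quasi_increasing m a"
  have "qless m (a ! i) (a ! Suc i)" if "Suc i < length a" for i
    using q[unfolded quasi_increasing_def, rule_format, of "Suc i"] that
    by (simp add: ltr_def qless_def)
  then show "successively (qless m) a"
    by (simp add: successively_conv_nth)
next
  assume q: "successively (qless m) a"
  have "qless m (ltr a r) (ltr a (r + 1))" if "1 \<le> r" "r < length a" for r
    using successively_nth[OF q, of "r - 1"] that by (simp add: ltr_def)
  then show "quasi_increasing m a"
    by (simp add: quasi_increasing_def qless_def)
qed

lemma prec_iff_rank:
  "x \<in> alphabet m \<Longrightarrow> y \<in> alphabet m \<Longrightarrow> prec m x y \<longleftrightarrow> rank m x < rank m y"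
  by (cases x; cases y) (auto simp: alphabet_def)

lemma qless_rank:
  assumes "x \<in> alphabet m" "y \<in> alphabet m" "qless m x y"
  shows "rank m x < rank m y \<or> rank m x = m \<and> rank m y = m"
  using assms prec_iff_rank[OF assms(1,2)] by (auto simp: qless_def mixed_pairs_def)

text \<open>Unlike \<open>qless\<close>, the relation between ranks is transitive, so it passes from consecutive
  letters to arbitrary ones.\<close>

lemma quasi_increasing_rank:
  assumes "quasi_increasing m a" "set a \<subseteq> alphabet m" "i < j" "j < length a"
  shows "rank m (a ! i) < rank m (a ! j) \<or> rank m (a ! i) = m \<and> rank m (a ! j) = m"
proof -
  let ?R = "\<lambda>x y. rank m x < rank m y \<or> rank m x = m \<and> rank m y = m"
  have "successively ?R a"
    using assms(1,2) qless_rank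
    unfolding quasi_increasing_iff by (elim successively_mono) blast
  moreover have "transp ?R"
    by (auto simp: transp_def)
  ultimately have "sorted_wrt ?R a"
    by (simp add: successively_conv_sorted_wrt)
  then show ?thesis
    using assms(3,4) by (simp add: sorted_wrt_iff_nth_less)
qed

lemma Unbar_iff_rank:
  "x \<in> alphabet m \<Longrightarrow> z < m \<Longrightarrow> x = Unbar z \<longleftrightarrow> rank m x = z"
  by (cases x) (auto simp: alphabet_def)

lemma middle_iff_rank:
  "x \<in> alphabet m \<Longrightarrow> x \<in> {Unbar m, Bar m} \<longleftrightarrow> rank m x = m"
  by (cases x) (auto simp: alphabet_def)

lemma letter_abs_le_iff_rank:
  "x \<in> alphabet m \<Longrightarrow> y < m \<Longrightarrow> letter_abs x \<le> y \<longleftrightarrow> rank m x \<le> y \<or> 2 * m - y \<le> rank m x"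
  by (cases x) (auto simp: alphabet_def)

lemma rank_less_middleE:
  assumes "x \<in> alphabet m" "rank m x < m"
  obtains z where "x = Unbar z" "1 \<le> z" "z < m"
  using assms by (cases x) (auto simp: alphabet_def)

lemma rank_greater_middleE:
  assumes "x \<in> alphabet m" "m < rank m x"
  obtains z where "x = Bar z" "1 \<le> z" "z < m"
  using assms by (cases x) (auto simp: alphabet_def)

text \<open>Below rank \<open>m\<close> the ranks strictly increase, so the letters in front of \<open>Unbar x\<close> are exactly the
  unbarred ones smaller than \<open>x\<close>. This turns positions into cardinalities.\<close>

lemma card_unbarred_upto:
  assumes a: "quasi_increasing m a" "set a \<subseteq> alphabet m"
    and i: "i < length a" "a ! i = Unbar x" "x < m"
  shows "card {z. z \<le> x \<and> Unbar z \<in> set a} = Suc i"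
proof -
  have al: "a ! k \<in> alphabet m" if "k < length a" for k
    using a(2) that nth_mem by blast
  have "{z. z \<le> x \<and> Unbar z \<in> set a} = (\<lambda>k. rank m (a ! k)) ` {..i}"
  proof (intro equalityI subsetI)
    fix z assume "z \<in> {z. z \<le> x \<and> Unbar z \<in> set a}"
    then obtain k where k: "z \<le> x" "k < length a" "a ! k = Unbar z"
      by (auto simp: in_set_conv_nth)
    have "k \<le> i"
    proof (rule ccontr)
      assume "\<not> k \<le> i"
      then show False
        using quasi_increasing_rank[OF a, of i k] k i by auto
    qed
    then show "z \<in> (\<lambda>k. rank m (a ! k)) ` {..i}"
      using k(3) by (intro image_eqI[of _ _ k]) auto
  next
    fix z assume "z \<in> (\<lambda>k. rank m (a ! k)) ` {..i}"
    then obtain k where k: "k \<le> i" "z = rank m (a ! k)"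
      by auto
    have "z \<le> x"
      using quasi_increasing_rank[OF a, of k i] k i by (cases "k = i") auto
    moreover have "Unbar z = a ! k"
      using Unbar_iff_rank[OF al, of k z] k i \<open>z \<le> x\<close> by auto
    ultimately show "z \<in> {z. z \<le> x \<and> Unbar z \<in> set a}"
      using k i by simp
  qed
  moreover have "inj_on (\<lambda>k. rank m (a ! k)) {..i}"
  proof (rule linorder_inj_onI)
    fix k l assume "k < l" "k \<in> {..i}" "l \<in> {..i}"
    moreover have "rank m (a ! l) < m"
      using quasi_increasing_rank[OF a, of l i] calculation i by (cases "l = i") auto
    ultimately show "rank m (a ! k) \<noteq> rank m (a ! l)"
      using quasi_increasing_rank[OF a, of k l] i by auto
  qed auto
  ultimately show ?thesis
    by (simp add: card_image)
qed

text \<open>The mirror image of the preceding lemma: behind \<open>Bar x\<close> stand exactly the smaller barred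
  letters.\<close>

lemma card_barred_upto:
  assumes a: "quasi_increasing m a" "set a \<subseteq> alphabet m"
    and i: "i < length a" "a ! i = Bar x" "x < m"
  shows "card {z. z \<le> x \<and> Bar z \<in> set a} = length a - i"
proof -
  have al: "a ! k \<in> alphabet m" if "k < length a" for k
    using a(2) that nth_mem by blast
  have "{z. z \<le> x \<and> Bar z \<in> set a} = (\<lambda>k. 2 * m - rank m (a ! k)) ` {i..<length a}"
  proof (intro equalityI subsetI)
    fix z assume "z \<in> {z. z \<le> x \<and> Bar z \<in> set a}"
    then obtain k where k: "z \<le> x" "k < length a" "a ! k = Bar z"
      by (auto simp: in_set_conv_nth)
    have "i \<le> k"
    proof (rule ccontr)
      assume "\<not> i \<le> k"
      then show False
        using quasi_increasing_rank[OF a, of k i] k i by auto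
    qed
    then show "z \<in> (\<lambda>k. 2 * m - rank m (a ! k)) ` {i..<length a}"
      using k i by (intro image_eqI[of _ _ k]) auto
  next
    fix z assume "z \<in> (\<lambda>k. 2 * m - rank m (a ! k)) ` {i..<length a}"
    then obtain k where k: "i \<le> k" "k < length a" "z = 2 * m - rank m (a ! k)"
      by auto
    have "2 * m - x \<le> rank m (a ! k)"
      using quasi_increasing_rank[OF a, of i k] k i by (cases "k = i") auto
    then have "m < rank m (a ! k)"
      using i(3) by linarith
    then obtain w where w: "a ! k = Bar w" "w < m"
      using rank_greater_middleE[OF al[OF k(2)]] by blast
    then show "z \<in> {z. z \<le> x \<and> Bar z \<in> set a}"
      using k \<open>2 * m - x \<le> rank m (a ! k)\<close> i nth_mem[OF k(2)] by auto
  qed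
  moreover have "inj_on (\<lambda>k. 2 * m - rank m (a ! k)) {i..<length a}"
  proof (rule linorder_inj_onI)
    fix k l assume kl: "k < l" "k \<in> {i..<length a}" "l \<in> {i..<length a}"
    have "m < rank m (a ! k)"
      using quasi_increasing_rank[OF a, of i k] kl i by (cases "k = i") auto
    then have "rank m (a ! k) < rank m (a ! l)"
      using quasi_increasing_rank[OF a, of k l] kl by auto
    moreover obtain w where "a ! l = Bar w" "w < m" "1 \<le> w"
      using rank_greater_middleE[OF al, of l] kl calculation \<open>m < rank m (a ! k)\<close> by auto
    ultimately show "2 * m - rank m (a ! k) \<noteq> 2 * m - rank m (a ! l)"
      by auto
  qed auto
  ultimately show ?thesis
    by (simp add: card_image)
qed

section \<open>Columns with the largest letter removed\<close>

primrec raise_letter :: "letter \<Rightarrow> letter" where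
  "raise_letter (Unbar a) = Unbar (Suc a)"
| "raise_letter (Bar a) = Bar (Suc a)"

text \<open>The inverse of \<open>reduce_column\<close>, given the information whether a letter \<open>Bar 1\<close> was deleted.\<close>

definition raise_column :: "bool \<Rightarrow> word \<Rightarrow> word" where
  "raise_column c w = map raise_letter w @ (if c then [Bar 1] else [])"

lemma lower_raise [simp]: "lower_letter (raise_letter x) = x"
  by (cases x) auto

lemma inj_raise_letter: "inj raise_letter"
  by (metis injI lower_raise)

lemma length_raise_column [simp]: "length (raise_column c w) = length w + of_bool c"
  by (simp add: raise_column_def)

lemma raise_letter_neq [simp]:
  "x \<in> alphabet m \<Longrightarrow> raise_letter x \<noteq> Bar (Suc 0)"
  "x \<in> alphabet m \<Longrightarrow> raise_letter x \<noteq> Unbar (Suc 0)"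
  by (auto simp: alphabet_def)

lemma reduce_raise_column:
  assumes "set w \<subseteq> alphabet m"
  shows "reduce_column (raise_column c w) = w"
proof -
  have "filter (\<lambda>x. x \<noteq> Bar 1) (map raise_letter w) = map raise_letter w"
    using assms by (auto simp: filter_id_conv)
  then show ?thesis
    by (simp add: reduce_column_def raise_column_def o_def)
qed

lemma prec_raise: "prec (Suc m) (raise_letter x) (raise_letter y) \<longleftrightarrow> prec m x y"
  by (cases x; cases y) auto

lemma preceq_raise: "preceq (Suc m) (raise_letter x) (raise_letter y) \<longleftrightarrow> preceq m x y"
  using injD[OF inj_raise_letter] by (auto simp: preceq_def prec_raise)

lemma pairs_raise:
  "(raise_letter x, raise_letter y) \<in> mixed_pairs (Suc m) \<longleftrightarrow> (x, y) \<in> mixed_pairs m"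
  "(raise_letter x, raise_letter y) \<in> same_pairs (Suc m) \<longleftrightarrow> (x, y) \<in> same_pairs m"
  by (cases x; cases y; auto simp: mixed_pairs_def same_pairs_def)+

lemma qless_raise: "qless (Suc m) (raise_letter x) (raise_letter y) \<longleftrightarrow> qless m x y"
  by (simp add: qless_def prec_raise pairs_raise)

lemma raise_letter_eq [simp]:
  "raise_letter x = Unbar (Suc z) \<longleftrightarrow> x = Unbar z"
  "raise_letter x = Bar (Suc z) \<longleftrightarrow> x = Bar z"
  "Unbar (Suc z) = raise_letter x \<longleftrightarrow> Unbar z = x"
  "Bar (Suc z) = raise_letter x \<longleftrightarrow> Bar z = x"
  by (cases x; auto)+

lemma prec_Bar_1:
  assumes "1 \<le> m" "x \<in> alphabet m"
  shows "prec (Suc m) (raise_letter x) (Bar 1)"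
  using assms by (cases x) (auto simp: alphabet_def)

lemma raise_letter_alphabet: "raise_letter x \<in> alphabet (Suc m) \<longleftrightarrow> x \<in> alphabet m \<or> x \<in> {Unbar 0, Bar 0}"
  by (cases x) (auto simp: alphabet_def)

lemma Bar_1_last:
  assumes "quasi_increasing (Suc m) a" "set a \<subseteq> alphabet (Suc m)" "1 \<le> m"
  shows "a = filter (\<lambda>x. x \<noteq> Bar 1) a @ (if Bar 1 \<in> set a then [Bar 1] else [])"
proof -
  have "successively (qless (Suc m)) a"
    using assms(1) by (simp add: quasi_increasing_iff)
  then show ?thesis
    using assms(2)
  proof (induction a)
    case (Cons x a)
    have "a = []" if "x = Bar 1"
    proof (rule ccontr)
      assume "a \<noteq> []"
      then have "qless (Suc m) (Bar 1) (hd a)" "hd a \<in> alphabet (Suc m)"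
        using Cons.prems that by (auto simp: successively_Cons)
      then show False
        using assms(3) by (cases "hd a") (auto simp: alphabet_def qless_def mixed_pairs_def)
    qed
    then show ?case
      using Cons by (auto simp: successively_Cons)
  qed auto
qed

lemma raise_reduce_column:
  assumes "quasi_increasing (Suc m) a" "set a \<subseteq> alphabet (Suc m)" "1 \<le> m" "Unbar 1 \<notin> set a"
  shows "raise_column (Bar 1 \<in> set a) (reduce_column a) = a"
    and "set (reduce_column a) \<subseteq> alphabet m"
proof -
  have *: "raise_letter (lower_letter x) = x" "lower_letter x \<in> alphabet m"
    if x: "x \<in> set a" "x \<noteq> Bar 1" for x
  proof -
    have "x \<in> alphabet (Suc m)" "x \<noteq> Unbar 1"
      using assms(2,4) x by auto
    then obtain z where "x = Unbar (Suc z) \<or> x = Bar (Suc z)" "1 \<le> z" "z \<le> m"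
      using x(2) by (cases x; cases "letter_abs x") (auto simp: alphabet_def Suc_le_eq)
    then show "raise_letter (lower_letter x) = x" "lower_letter x \<in> alphabet m"
      by (auto simp: alphabet_def)
  qed
  have "map raise_letter (reduce_column a) = filter (\<lambda>x. x \<noteq> Bar 1) a"
    using *(1) by (auto simp: reduce_column_def o_def intro: map_idI)
  then show "raise_column (Bar 1 \<in> set a) (reduce_column a) = a"
    using Bar_1_last[OF assms(1-3)] by (simp add: raise_column_def)
  show "set (reduce_column a) \<subseteq> alphabet m"
    using *(2) by (auto simp: reduce_column_def)
qed

lemma both_signs_raise_column:
  assumes "set w \<subseteq> alphabet m"
  shows "both_signs (Suc m) (raise_column c w) = Suc ` both_signs m w"
proof (intro equalityI subsetI)
  fix b assume b: "b \<in> both_signs (Suc m) (raise_column c w)"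
  then obtain z where z: "b = Suc z" "z \<le> m"
    by (cases b) (auto simp: both_signs_def)
  have "Unbar b \<in> set (raise_column c w)" "Bar b \<in> set (raise_column c w)"
    using b by (auto simp: both_signs_def)
  moreover from this(1) have "Unbar z \<in> set w"
    using z by (auto simp: raise_column_def split: if_splits)
  moreover from this have "1 \<le> z"
    using assms by (auto simp: alphabet_def)
  ultimately show "b \<in> Suc ` both_signs m w"
    using z by (auto simp: both_signs_def raise_column_def split: if_splits)
next
  fix b assume "b \<in> Suc ` both_signs m w"
  then show "b \<in> both_signs (Suc m) (raise_column c w)"
    by (force simp: both_signs_def raise_column_def)
qed

lemma letter_abs_raise [simp]: "letter_abs (raise_letter x) = Suc (letter_abs x)"
  by (cases x) auto

lemma length_sub_le_raise_column:
  "length (sub_le (Suc b) (raise_column c w)) = length (sub_le b w) + of_bool c"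
  by (simp add: sub_le_def raise_column_def filter_map o_def)

lemma length_sub_le_sub_gt_raise_column:
  assumes "set w \<subseteq> alphabet m"
  shows "length (sub_le (Suc b) (sub_gt 1 (raise_column c w))) = length (sub_le b w)"
proof -
  have "1 \<le> letter_abs x" if "x \<in> set w" for x
    using assms that by (cases x) (auto simp: alphabet_def)
  then have "filter (\<lambda>x. Suc 0 < letter_abs x) (map raise_letter w) = map raise_letter w"
    by (auto simp: filter_id_conv Suc_le_eq)
  then show ?thesis
    by (simp add: sub_le_def sub_gt_def raise_column_def filter_map o_def)
qed

text \<open>The strict bound in the DII condition counts the letters of \<open>w\<close> up to \<open>b\<close> against \<open>b + 1\<close>, hence is
  the KN bound for \<open>w\<close>. The KN bound for the raised column also counts a possible \<open>Bar 1\<close>, for which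
  the increase of \<open>b\<close> to \<open>b + 1\<close> leaves room.\<close>

lemma DII_raise_column_iff:
  assumes w: "set w \<subseteq> alphabet m" and m: "1 \<le> m"
  shows "DII_column (Suc m) (raise_column c w) \<longleftrightarrow> KN_column m w \<and> length (raise_column c w) \<le> m"
proof -
  have sub: "set (raise_column c w) \<subseteq> alphabet (Suc m)"
    using w m by (auto simp: raise_column_def raise_letter_alphabet) (auto simp: alphabet_def)
  have q: "quasi_increasing (Suc m) (raise_column c w) \<longleftrightarrow> quasi_increasing m w"
  proof -
    have "qless (Suc m) (last (map raise_letter w)) (Bar 1)" if "w \<noteq> []"
      using prec_Bar_1[OF m subsetD[OF w last_in_set[OF that]]] that
      by (simp add: qless_def last_map)
    then show ?thesis
      by (auto simp: quasi_increasing_iff raise_column_def successively_append_iff successively_map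
          qless_raise)
  qed
  have one: "Unbar 1 \<notin> set (raise_column c w)"
    using w by (auto simp: raise_column_def dest: raise_letter_neq(2)[OF subsetD])
  show ?thesis
    unfolding DII_column_def KN_column_def both_signs_raise_column[OF w]
    using sub q one w length_sub_le_sub_gt_raise_column[OF w]
    by (auto simp: length_sub_le_raise_column less_Suc_eq_le)
qed

section \<open>Adjacency of columns\<close>

text \<open>All but three of the adjacency conditions speak about a letter \<open>x\<close> of \<open>a\<close> and the letter \<open>Bar x\<close> of
  \<open>b\<close>, in the places \<open>r \<le> u\<close>, and about what lies between them. The occurrence of such a pair is
  separated here from the inner conditions that it entails, because raising a column acts on the
  pair and on the inner conditions independently. Places count from \<open>1\<close>, as in \<open>ltr\<close>.\<close>

definition barred_above :: "nat \<Rightarrow> word \<Rightarrow> word \<Rightarrow> nat \<Rightarrow> nat \<Rightarrow> nat \<Rightarrow> bool" where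
  "barred_above m a b x r u \<longleftrightarrow>
     1 \<le> x \<and> x \<le> m - 1 \<and> 1 \<le> r \<and> r \<le> u \<and> u \<le> length b \<and> ltr a r = Unbar x \<and> ltr b u = Bar x"

definition inner_condition :: "nat \<Rightarrow> word \<Rightarrow> word \<Rightarrow> nat \<Rightarrow> nat \<Rightarrow> nat \<Rightarrow> bool" where
  "inner_condition m a b x r u \<longleftrightarrow>
     (\<forall>y s t. x \<le> y \<and> y \<le> m - 1 \<and> r \<le> s \<and> s < t \<and> t \<le> u \<and>
        ((ltr b s, ltr b t) = (Unbar y, Bar y) \<or> (ltr a s, ltr a t) = (Unbar y, Bar y)) \<longrightarrow>
        (s - r) + (u - t) < y - x) \<and>
     (\<forall>s. r < s \<and> s < u \<and>
        ((ltr b s, ltr b (s + 1)) \<in> mixed_pairs m \<or> (ltr a s, ltr a (s + 1)) \<in> mixed_pairs m) \<longrightarrow>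
        u - r - 1 < m - x) \<and>
     (\<forall>s t. r \<le> s \<and> s < t \<and> t \<le> u \<and>
        (odd (t - s + 1) \<and> (ltr b s, ltr a t) \<in> mixed_pairs m \<or>
         even (t - s + 1) \<and> (ltr b s, ltr a t) \<in> same_pairs m) \<longrightarrow>
        u - r < m - x)"

lemma adjacent_iff:
  "adjacent m a b \<longleftrightarrow>
     length b \<le> length a \<and> b \<noteq> [] \<and>
     (\<forall>r. 1 \<le> r \<and> r \<le> length b \<longrightarrow> preceq m (ltr a r) (ltr b r)) \<and>
     (\<forall>s t. 1 \<le> s \<and> s < t \<and> t \<le> length b \<longrightarrow>
        \<not> (ltr a s \<in> {Unbar m, Bar m} \<and> ltr b t \<in> {Unbar m, Bar m})) \<and>
     (\<forall>x r u. barred_above m a b x r u \<longrightarrow> inner_condition m a b x r u)"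
  (is "?L \<longleftrightarrow> ?R")
proof
  assume ?L
  then have c:
    "length b \<le> length a" "0 < length b"
    "\<forall>r. 1 \<le> r \<and> r \<le> length b \<longrightarrow> preceq m (ltr a r) (ltr b r)"
    "\<nexists>s t. 1 \<le> s \<and> s < t \<and> t \<le> length b \<and>
        ltr a s \<in> {Unbar m, Bar m} \<and> ltr b t \<in> {Unbar m, Bar m}"
    and c3: "\<forall>x y r s t u. 1 \<le> x \<and> x \<le> y \<and> y \<le> m - 1 \<and>
        1 \<le> r \<and> r \<le> s \<and> s < t \<and> t \<le> u \<and> u \<le> length b \<and>
        ltr a r = Unbar x \<and> ltr b u = Bar x \<and>
        ((ltr b s, ltr b t) = (Unbar y, Bar y) \<or> (ltr a s, ltr a t) = (Unbar y, Bar y)) \<longrightarrow>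
        (s - r) + (u - t) < y - x"
    and c4: "\<forall>x r s u. 1 \<le> x \<and> x \<le> m - 1 \<and>
        1 \<le> r \<and> r < s \<and> s < u \<and> u \<le> length b \<and>
        ltr a r = Unbar x \<and> ltr b u = Bar x \<and>
        ((ltr b s, ltr b (s + 1)) \<in> mixed_pairs m \<or> (ltr a s, ltr a (s + 1)) \<in> mixed_pairs m) \<longrightarrow>
        u - r - 1 < m - x"
    and c6: "\<forall>x r s t u. 1 \<le> x \<and> x \<le> m - 1 \<and>
        1 \<le> r \<and> r \<le> s \<and> s < t \<and> t \<le> u \<and> u \<le> length b \<and>
        odd (t - s + 1) \<and> ltr a r = Unbar x \<and> ltr b u = Bar x \<and>
        (ltr b s, ltr a t) \<in> mixed_pairs m \<longrightarrow> u - r < m - x"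
    and c7: "\<forall>x r s t u. 1 \<le> x \<and> x \<le> m - 1 \<and>
        1 \<le> r \<and> r \<le> s \<and> s < t \<and> t \<le> u \<and> u \<le> length b \<and>
        even (t - s + 1) \<and> ltr a r = Unbar x \<and> ltr b u = Bar x \<and>
        (ltr b s, ltr a t) \<in> same_pairs m \<longrightarrow> u - r < m - x"
    unfolding adjacent_def by - (elim conjE, assumption)+
  have "inner_condition m a b x r u" if "barred_above m a b x r u" for x r u
    unfolding inner_condition_def
  proof (intro conjI allI impI; elim conjE)
    fix y s t assume "x \<le> y" "y \<le> m - 1" "r \<le> s" "s < t" "t \<le> u"
      "(ltr b s, ltr b t) = (Unbar y, Bar y) \<or> (ltr a s, ltr a t) = (Unbar y, Bar y)"
    then show "(s - r) + (u - t) < y - x"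
      using that by (intro c3[rule_format]) (auto simp: barred_above_def)
  next
    fix s assume "r < s" "s < u"
      "(ltr b s, ltr b (s + 1)) \<in> mixed_pairs m \<or> (ltr a s, ltr a (s + 1)) \<in> mixed_pairs m"
    then show "u - r - 1 < m - x"
      using that by (intro c4[rule_format, of x r s u]) (auto simp: barred_above_def)
  next
    fix s t assume st: "r \<le> s" "s < t" "t \<le> u"
      and "odd (t - s + 1) \<and> (ltr b s, ltr a t) \<in> mixed_pairs m \<or>
         even (t - s + 1) \<and> (ltr b s, ltr a t) \<in> same_pairs m"
    from this(4) show "u - r < m - x"
      using that st c6 c7 unfolding barred_above_def by blast
  qed
  then show ?R
    using c unfolding length_greater_0_conv by blast
next
  assume R: ?R
  have inner: "inner_condition m a b x r u" if "barred_above m a b x r u" for x r u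
    using R that by blast
  have ba: "barred_above m a b x r u"
    if "1 \<le> x" "x \<le> m - 1" "1 \<le> r" "r \<le> u" "u \<le> length b" "ltr a r = Unbar x" "ltr b u = Bar x" for x r u
    using that by (simp add: barred_above_def)
  show ?L
    unfolding adjacent_def
  proof (intro conjI allI impI; (elim conjE)?)
    show "length b \<le> length a" "0 < length b"
      using R by auto
    show "preceq m (ltr a r) (ltr b r)" if "1 \<le> r" "r \<le> length b" for r
      using R that by blast
    show "\<nexists>s t. 1 \<le> s \<and> s < t \<and> t \<le> length b \<and>
        ltr a s \<in> {Unbar m, Bar m} \<and> ltr b t \<in> {Unbar m, Bar m}"
      using R by blast
  next
    fix x y r s t u assume h: "1 \<le> x" "x \<le> y" "y \<le> m - 1" "1 \<le> r" "r \<le> s" "s < t" "t \<le> u"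
      "u \<le> length b" "ltr a r = Unbar x" "ltr b u = Bar x"
      "(ltr b s, ltr b t) = (Unbar y, Bar y) \<or> (ltr a s, ltr a t) = (Unbar y, Bar y)"
    then have "barred_above m a b x r u"
      by (intro ba) auto
    from inner[OF this] h show "(s - r) + (u - t) < y - x"
      unfolding inner_condition_def by blast
  next
    fix x r s u assume h: "1 \<le> x" "x \<le> m - 1" "1 \<le> r" "r < s" "s < u"
      "u \<le> length b" "ltr a r = Unbar x" "ltr b u = Bar x"
      "(ltr b s, ltr b (s + 1)) \<in> mixed_pairs m \<or> (ltr a s, ltr a (s + 1)) \<in> mixed_pairs m"
    then have "barred_above m a b x r u"
      by (intro ba) auto
    from inner[OF this] h show "u - r - 1 < m - x"
      unfolding inner_condition_def by blast
  next
    fix x r s t u assume h: "1 \<le> x" "x \<le> m - 1" "1 \<le> r" "r \<le> s" "s < t" "t \<le> u"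
      "u \<le> length b" "odd (t - s + 1)" "ltr a r = Unbar x" "ltr b u = Bar x"
      "(ltr b s, ltr a t) \<in> mixed_pairs m"
    then have "barred_above m a b x r u"
      by (intro ba) auto
    from inner[OF this] h show "u - r < m - x"
      unfolding inner_condition_def by blast
  next
    fix x r s t u assume h: "1 \<le> x" "x \<le> m - 1" "1 \<le> r" "r \<le> s" "s < t" "t \<le> u"
      "u \<le> length b" "even (t - s + 1)" "ltr a r = Unbar x" "ltr b u = Bar x"
      "(ltr b s, ltr a t) \<in> same_pairs m"
    then have "barred_above m a b x r u"
      by (intro ba) auto
    from inner[OF this] h show "u - r < m - x"
      unfolding inner_condition_def by blast
  qed
qed

lemma ltr_raise_column:
  assumes "1 \<le> r" "r \<le> length w"
  shows "ltr (raise_column c w) r = raise_letter (ltr w r)"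
proof -
  have "r - 1 < length w"
    using assms by linarith
  then show ?thesis
    by (simp add: ltr_def raise_column_def nth_append)
qed

lemma ltr_raise_column_last:
  assumes "length w < r" "r \<le> length (raise_column c w)"
  shows "ltr (raise_column c w) r = Bar 1"
  using assms by (auto simp: ltr_def raise_column_def nth_append split: if_splits)

lemma ltr_in_alphabet:
  "set w \<subseteq> alphabet m \<Longrightarrow> 1 \<le> r \<Longrightarrow> r \<le> length w \<Longrightarrow> ltr w r \<in> alphabet m"
  by (auto simp: ltr_def)

text \<open>A raised word has no letter \<open>1\<close>, so \<open>x\<close> is at least \<open>2\<close> and neither member of the pair can be an
  appended \<open>Bar 1\<close>.\<close>

lemma barred_above_raise_column:
  assumes w: "set w \<subseteq> alphabet m" and m: "1 \<le> m" and len: "length v \<le> length w"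
    "length (raise_column d v) \<le> length (raise_column c w)"
  shows "barred_above (Suc m) (raise_column c w) (raise_column d v) x r u \<longleftrightarrow>
    (\<exists>z. x = Suc z \<and> barred_above m w v z r u)"
  (is "?L \<longleftrightarrow> ?R")
proof
  assume L: ?L
  have r: "r \<le> length w"
    using ltr_raise_column_last[of w r c] L len by (force simp: barred_above_def)
  obtain z where z: "x = Suc z"
    using L by (cases x) (auto simp: barred_above_def)
  have wr: "ltr w r = Unbar z"
    using ltr_raise_column[of r w c] L z r by (auto simp: barred_above_def)
  then have "1 \<le> z"
    using ltr_in_alphabet[OF w, of r] L r by (auto simp: barred_above_def alphabet_def)
  moreover have "u \<le> length v"
    using ltr_raise_column_last[of v u d] L z calculation by (force simp: barred_above_def)
  ultimately show ?R
    using L z wr ltr_raise_column[of u v d] by (auto simp: barred_above_def)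
next
  assume ?R
  then show ?L
    using len ltr_raise_column[of r w c] ltr_raise_column[of u v d] by (auto simp: barred_above_def)
qed

lemma inner_condition_raise_column:
  assumes len: "length v \<le> length w" and ur: "1 \<le> r" "u \<le> length v" and m: "1 \<le> m"
  shows "inner_condition (Suc m) (raise_column c w) (raise_column d v) (Suc x) r u \<longleftrightarrow>
    inner_condition m w v x r u"
    (is "inner_condition _ ?a ?b _ _ _ \<longleftrightarrow> _")
proof -
  have w: "ltr (raise_column c w) s = raise_letter (ltr w s)" if "r \<le> s" "s \<le> u" for s
    using that ur len by (intro ltr_raise_column) auto
  have v: "ltr (raise_column d v) s = raise_letter (ltr v s)" if "r \<le> s" "s \<le> u" for s
    using that ur len by (intro ltr_raise_column) auto
  have 1: "(\<forall>y s t. Suc x \<le> y \<and> y \<le> Suc m - 1 \<and> r \<le> s \<and> s < t \<and> t \<le> u \<and>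
        ((ltr (raise_column d v) s, ltr (raise_column d v) t) = (Unbar y, Bar y) \<or>
         (ltr (raise_column c w) s, ltr (raise_column c w) t) = (Unbar y, Bar y)) \<longrightarrow>
        (s - r) + (u - t) < y - Suc x) \<longleftrightarrow>
     (\<forall>y s t. x \<le> y \<and> y \<le> m - 1 \<and> r \<le> s \<and> s < t \<and> t \<le> u \<and>
        ((ltr v s, ltr v t) = (Unbar y, Bar y) \<or> (ltr w s, ltr w t) = (Unbar y, Bar y)) \<longrightarrow>
        (s - r) + (u - t) < y - x)" (is "?P \<longleftrightarrow> ?Q")
  proof
    assume P: ?P
    show ?Q
    proof (intro allI impI)
      fix y s t
      assume "x \<le> y \<and> y \<le> m - 1 \<and> r \<le> s \<and> s < t \<and> t \<le> u \<and>
        ((ltr v s, ltr v t) = (Unbar y, Bar y) \<or> (ltr w s, ltr w t) = (Unbar y, Bar y))"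
      then show "(s - r) + (u - t) < y - x"
        using P[rule_format, of "Suc y" s t] w[of s] w[of t] v[of s] v[of t] m by auto
    qed
  next
    assume Q: ?Q
    show ?P
    proof (intro allI impI)
      fix y s t
      assume *: "Suc x \<le> y \<and> y \<le> Suc m - 1 \<and> r \<le> s \<and> s < t \<and> t \<le> u \<and>
        ((ltr (raise_column d v) s, ltr (raise_column d v) t) = (Unbar y, Bar y) \<or>
         (ltr (raise_column c w) s, ltr (raise_column c w) t) = (Unbar y, Bar y))"
      then obtain y' where "y = Suc y'"
        by (cases y) auto
      with * show "(s - r) + (u - t) < y - Suc x"
        using Q[rule_format, of y' s t] w[of s] w[of t] v[of s] v[of t] by auto
    qed
  qed
  have 2: "(\<forall>s. r < s \<and> s < u \<and>
        ((ltr ?b s, ltr ?b (s + 1)) \<in> mixed_pairs (Suc m) \<or>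
         (ltr ?a s, ltr ?a (s + 1)) \<in> mixed_pairs (Suc m)) \<longrightarrow> P) \<longleftrightarrow>
     (\<forall>s. r < s \<and> s < u \<and>
        ((ltr v s, ltr v (s + 1)) \<in> mixed_pairs m \<or> (ltr w s, ltr w (s + 1)) \<in> mixed_pairs m) \<longrightarrow> P)"
    for P
  proof -
    have "(ltr ?b s, ltr ?b (s + 1)) \<in> mixed_pairs (Suc m) \<longleftrightarrow> (ltr v s, ltr v (s + 1)) \<in> mixed_pairs m"
      "(ltr ?a s, ltr ?a (s + 1)) \<in> mixed_pairs (Suc m) \<longleftrightarrow> (ltr w s, ltr w (s + 1)) \<in> mixed_pairs m"
      if "r < s" "s < u" for s
      using that by (simp_all add: v w pairs_raise)
    then show ?thesis
      by blast
  qed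
  have 3: "(\<forall>s t. r \<le> s \<and> s < t \<and> t \<le> u \<and>
        (odd (t - s + 1) \<and> (ltr ?b s, ltr ?a t) \<in> mixed_pairs (Suc m) \<or>
         even (t - s + 1) \<and> (ltr ?b s, ltr ?a t) \<in> same_pairs (Suc m)) \<longrightarrow> P) \<longleftrightarrow>
     (\<forall>s t. r \<le> s \<and> s < t \<and> t \<le> u \<and>
        (odd (t - s + 1) \<and> (ltr v s, ltr w t) \<in> mixed_pairs m \<or>
         even (t - s + 1) \<and> (ltr v s, ltr w t) \<in> same_pairs m) \<longrightarrow> P)" for P
  proof -
    have "(ltr ?b s, ltr ?a t) \<in> mixed_pairs (Suc m) \<longleftrightarrow> (ltr v s, ltr w t) \<in> mixed_pairs m"
      "(ltr ?b s, ltr ?a t) \<in> same_pairs (Suc m) \<longleftrightarrow> (ltr v s, ltr w t) \<in> same_pairs m"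
      if "r \<le> s" "s < t" "t \<le> u" for s t
      using that by (simp_all add: v w pairs_raise)
    then show ?thesis
      by blast
  qed
  show ?thesis
    unfolding inner_condition_def 1 2 3 diff_Suc_Suc by (rule refl)
qed

text \<open>A nonempty column with \<open>v = []\<close> is the single letter \<open>Bar 1\<close>, which may follow any nonempty
  column. For \<open>v \<noteq> []\<close> the
  comparison of rows does two things: in the rows of \<open>v\<close> it compares \<open>w\<close> with \<open>v\<close>, and it keeps a
  final \<open>Bar 1\<close> of the left column away from these rows, so that \<open>v\<close> is not longer than \<open>w\<close>.\<close>

lemma adjacent_raise_column_iff:
  assumes w: "set w \<subseteq> alphabet m" and v: "set v \<subseteq> alphabet m" and m: "1 \<le> m"
  shows "adjacent (Suc m) (raise_column c w) (raise_column d v) \<longleftrightarrow>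
    length (raise_column d v) \<le> length (raise_column c w) \<and> raise_column d v \<noteq> [] \<and>
    (v \<noteq> [] \<longrightarrow> adjacent m w v)"
  (is "adjacent _ ?a ?b \<longleftrightarrow> _")
proof (cases "length ?b \<le> length ?a \<and> ?b \<noteq> []")
  case True
  have max: "preceq (Suc m) (ltr ?a r) (Bar 1)" if "1 \<le> r" "r \<le> length ?a" for r
  proof (cases "r \<le> length w")
    case True
    then show ?thesis
      using prec_Bar_1[OF m ltr_in_alphabet[OF w]] that by (simp add: preceq_def ltr_raise_column)
  qed (use that ltr_raise_column_last[of w r c] in \<open>auto simp: preceq_def\<close>)
  show ?thesis
  proof (cases "v = []")
    case True
    then have b: "?b = [Bar 1]"
      using \<open>length ?b \<le> length ?a \<and> ?b \<noteq> []\<close> by (auto simp: raise_column_def split: if_splits)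
    have a: "1 \<le> length ?a"
      using \<open>length ?b \<le> length ?a \<and> ?b \<noteq> []\<close> unfolding b by simp
    have "inner_condition (Suc m) ?a [Bar 1] x r u" if "barred_above (Suc m) ?a [Bar 1] x r u" for x r u
      using that unfolding barred_above_def inner_condition_def by fastforce
    moreover have "preceq (Suc m) (ltr ?a r) (ltr [Bar 1] r)" if "1 \<le> r \<and> r \<le> length [Bar 1]" for r
      using max[of r] that a by (simp add: ltr_def)
    moreover have "\<not> (1 \<le> s \<and> s < t \<and> t \<le> length [Bar 1])" for s t :: nat
      by simp
    moreover have "length [Bar 1] \<le> length ?a" "[Bar 1] \<noteq> []"
      using a by simp_all
    ultimately have "adjacent (Suc m) ?a [Bar 1]"
      unfolding adjacent_iff by blast
    then show ?thesis
      using \<open>v = []\<close> b a by simp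
  next
    case False
    have preceq: "(\<forall>r. 1 \<le> r \<and> r \<le> length ?b \<longrightarrow> preceq (Suc m) (ltr ?a r) (ltr ?b r)) \<longleftrightarrow>
      length v \<le> length w \<and> (\<forall>r. 1 \<le> r \<and> r \<le> length v \<longrightarrow> preceq m (ltr w r) (ltr v r))"
      (is "?P \<longleftrightarrow> ?Q")
    proof
      assume P: ?P
      have "length v \<le> length w"
      proof (rule ccontr)
        assume "\<not> length v \<le> length w"
        then have "ltr ?a (length v) = Bar 1"
          using True by (intro ltr_raise_column_last) auto
        then have "preceq (Suc m) (Bar 1) (raise_letter (ltr v (length v)))"
          using P[rule_format, of "length v"] ltr_raise_column[of "length v" v d] False
          by (simp add: Suc_le_eq)
        moreover have "ltr v (length v) \<in> alphabet m"
          using ltr_in_alphabet[OF v, of "length v"] False by (simp add: Suc_le_eq)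
        ultimately show False
          by (cases "ltr v (length v)") (auto simp: preceq_def alphabet_def)
      qed
      moreover have "preceq m (ltr w r) (ltr v r)" if "1 \<le> r" "r \<le> length v" for r
        using P[rule_format, of r] that calculation
        by (simp add: ltr_raise_column preceq_raise)
      ultimately show ?Q
        by blast
    next
      assume Q: ?Q
      show ?P
      proof (intro allI impI)
        fix r assume r: "1 \<le> r \<and> r \<le> length ?b"
        show "preceq (Suc m) (ltr ?a r) (ltr ?b r)"
        proof (cases "r \<le> length v")
          case True
          then show ?thesis
            using Q r by (simp add: ltr_raise_column preceq_raise)
        next
          case False
          then show ?thesis
            using max[of r] ltr_raise_column_last[of v r d] r True by simp
        qed
      qed
    qed
    show ?thesis
    proof (cases "length v \<le> length w")
      case le: True
      have middle: "ltr (raise_column c u) s \<in> {Unbar (Suc m), Bar (Suc m)} \<longleftrightarrow>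
          s \<le> length u \<and> ltr u s \<in> {Unbar m, Bar m}"
        if "1 \<le> s" "s \<le> length (raise_column c u)" for u s c
        using that m ltr_raise_column[of s u c] ltr_raise_column_last[of u s c]
        by (cases "s \<le> length u") auto
      have "(\<forall>s t. 1 \<le> s \<and> s < t \<and> t \<le> length ?b \<longrightarrow>
          \<not> (ltr ?a s \<in> {Unbar (Suc m), Bar (Suc m)} \<and> ltr ?b t \<in> {Unbar (Suc m), Bar (Suc m)})) \<longleftrightarrow>
        (\<forall>s t. 1 \<le> s \<and> s < t \<and> t \<le> length v \<longrightarrow>
          \<not> (ltr w s \<in> {Unbar m, Bar m} \<and> ltr v t \<in> {Unbar m, Bar m}))" (is "?P \<longleftrightarrow> ?Q")
      proof
        assume P: ?P
        show ?Q
        proof (intro allI impI)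
          fix s t assume "1 \<le> s \<and> s < t \<and> t \<le> length v"
          then show "\<not> (ltr w s \<in> {Unbar m, Bar m} \<and> ltr v t \<in> {Unbar m, Bar m})"
            using P[rule_format, of s t] middle[of s c w] middle[of t d v] le by auto
        qed
      next
        assume Q: ?Q
        show ?P
        proof (intro allI impI)
          fix s t assume "1 \<le> s \<and> s < t \<and> t \<le> length ?b"
          then show "\<not> (ltr ?a s \<in> {Unbar (Suc m), Bar (Suc m)} \<and> ltr ?b t \<in> {Unbar (Suc m), Bar (Suc m)})"
            using Q[rule_format, of s t] middle[of s c w] middle[of t d v] True by auto
        qed
      qed
      moreover have "(\<forall>x r u. barred_above (Suc m) ?a ?b x r u \<longrightarrow> inner_condition (Suc m) ?a ?b x r u) \<longleftrightarrow>
        (\<forall>x r u. barred_above m w v x r u \<longrightarrow> inner_condition m w v x r u)"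
      proof -
        have "inner_condition (Suc m) ?a ?b (Suc x) r u \<longleftrightarrow> inner_condition m w v x r u"
          if "barred_above m w v x r u" for x r u
          using that by (intro inner_condition_raise_column le m) (auto simp: barred_above_def)
        moreover have "barred_above (Suc m) ?a ?b x r u \<longleftrightarrow> (\<exists>z. x = Suc z \<and> barred_above m w v z r u)"
          for x r u
          using True by (intro barred_above_raise_column[OF w m le]) simp
        ultimately show ?thesis
          by (simp only:) metis
      qed
      ultimately show ?thesis
        using preceq True False le unfolding adjacent_iff by blast
    next
      case False
      then show ?thesis
        using preceq \<open>v \<noteq> []\<close> unfolding adjacent_iff by blast
    qed
  qed
qed (auto simp: adjacent_iff)

lemma adjacent_nth_preceq:
  assumes "adjacent m a b" "i < length b"
  shows "preceq m (a ! i) (b ! i)"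
proof -
  have "1 \<le> Suc i \<and> Suc i \<le> length b"
    using assms(2) by simp
  then have "preceq m (ltr a (Suc i)) (ltr b (Suc i))"
    using assms(1) unfolding adjacent_iff by blast
  then show ?thesis
    by (simp add: ltr_def)
qed

lemma preceq_rank:
  assumes "preceq m x y" "x \<in> alphabet m" "y \<in> alphabet m"
  shows "x = y \<or> rank m x < rank m y"
  using assms prec_iff_rank by (auto simp: preceq_def)

lemma adjacent_inner_condition:
  assumes "adjacent m a b" "1 \<le> x" "x < m" "r \<le> u" "u < length b" "a ! r = Unbar x" "b ! u = Bar x"
  shows "inner_condition m a b x (Suc r) (Suc u)"
proof -
  have "barred_above m a b x (Suc r) (Suc u)"
    using assms(2-) by (auto simp: barred_above_def ltr_def)
  then show ?thesis
    using assms(1) by (simp add: adjacent_iff)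
qed

section \<open>Columns to the right of a DII column\<close>

text \<open>The letters up to \<open>y < m\<close> form an initial segment of the word, ending with \<open>Unbar y\<close>, and a final
  segment, beginning with \<open>Bar y\<close>.\<close>

lemma length_sub_le_between:
  assumes b: "quasi_increasing m b" "set b \<subseteq> alphabet m"
    and st: "s < length b" "t < length b" "b ! s = Unbar y" "b ! t = Bar y" "y < m"
  shows "s < t" and "length (sub_le y b) = Suc s + (length b - t)"
proof -
  have al: "b ! i \<in> alphabet m" if "i < length b" for i
    using b(2) that nth_mem by blast
  show "s < t"
  proof (rule ccontr)
    assume "\<not> s < t"
    then show False
      using quasi_increasing_rank[OF b, of t s] st by (cases "s = t") auto
  qed
  have "letter_abs (b ! i) \<le> y \<longleftrightarrow> i \<le> s \<or> t \<le> i" if i: "i < length b" for i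
  proof -
    have "rank m (b ! i) \<le> y \<longleftrightarrow> i \<le> s"
      using quasi_increasing_rank[OF b, of i s] quasi_increasing_rank[OF b, of s i] i st
      by (cases i s rule: linorder_cases) auto
    moreover have "2 * m - y \<le> rank m (b ! i) \<longleftrightarrow> t \<le> i"
      using quasi_increasing_rank[OF b, of i t] quasi_increasing_rank[OF b, of t i] i st
      by (cases i t rule: linorder_cases) auto
    ultimately show ?thesis
      using letter_abs_le_iff_rank[OF al[OF i] st(5)] by simp
  qed
  then have "{i. i < length b \<and> letter_abs (b ! i) \<le> y} = {..s} \<union> {t..<length b}"
    using st by auto
  moreover have "card ({..s} \<union> {t..<length b}) = Suc s + (length b - t)"
    using \<open>s < t\<close> by (subst card_Un_disjoint) auto
  ultimately show "length (sub_le y b) = Suc s + (length b - t)"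
    by (simp add: sub_le_def length_filter_conv_card)
qed

text \<open>If the column \<open>b\<close> violates the DII bound at \<open>y\<close>, then it has exactly \<open>y\<close> letters up to \<open>y\<close>, none of them
  \<open>1\<close> or \<open>Bar 1\<close>, and \<open>y < n\<close> because \<open>b\<close> is no longer than \<open>a\<close>: unbarred ones up to place \<open>s\<close>, barred ones from place \<open>t\<close> on. In the
  places up to \<open>s\<close> the column \<open>a\<close> has unbarred letters up to \<open>y\<close> as well. Their set \<open>A\<close> and the set
  \<open>B\<close> of the barred letters of \<open>b\<close> have together \<open>y\<close> elements among \<open>2, \<dots>, y\<close>, and their
  least common element contradicts the adjacency condition for the pair \<open>Unbar y\<close>, \<open>Bar y\<close> of \<open>b\<close>.\<close>

lemma DII_column_adjacent:
  assumes a: "KN_column n a" "length a < n" "Unbar 1 \<notin> set a"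
    and b: "KN_column n b" and adj: "adjacent n a b"
  shows "DII_column n b"
proof -
  have qa: "quasi_increasing n a" and sa: "set a \<subseteq> alphabet n"
    and qb: "quasi_increasing n b" and sb: "set b \<subseteq> alphabet n"
    using a(1) b by (auto simp: KN_column_def)
  have len: "length b \<le> length a"
    using adj by (simp add: adjacent_iff)
  have ala: "a ! i \<in> alphabet n" and alb: "b ! i \<in> alphabet n" if "i < length b" for i
    using sa sb that len nth_mem[of i a] nth_mem[of i b] by auto
  have small: "\<exists>z. a ! i = Unbar z \<and> 1 < z \<and> z \<le> y" if "i < length b" "b ! i = Unbar y" for i y
  proof -
    have "a ! i \<noteq> Unbar 1"
      using a(3) that(1) len nth_mem[of i a] by force
    then show ?thesis
      using adjacent_nth_preceq[OF adj that(1)] ala[OF that(1)] that(2)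
      by (cases "a ! i") (auto simp: preceq_def alphabet_def)
  qed
  have "Unbar 1 \<notin> set b"
    using small by (fastforce simp: in_set_conv_nth)
  moreover have "length (sub_le y (sub_gt 1 b)) < y" if y: "y \<in> both_signs n b" for y
  proof (rule ccontr)
    assume *: "\<not> length (sub_le y (sub_gt 1 b)) < y"
    have comm: "sub_le y (sub_gt 1 b) = sub_gt 1 (sub_le y b)"
      by (auto simp: sub_le_def sub_gt_def intro: filter_cong)
    have "length (sub_le y b) \<le> y"
      using b y by (simp add: KN_column_def)
    moreover have "length (sub_gt 1 (sub_le y b)) \<le> length (sub_le y b)"
      by (simp add: sub_gt_def)
    ultimately have full: "length (sub_le y b) = y"
      using * comm by simp
    have "Bar 1 \<notin> set b"
    proof
      assume "Bar 1 \<in> set b"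
      then have "Bar 1 \<in> set (sub_le y b)"
        using y by (auto simp: sub_le_def both_signs_def)
      then have "length (sub_gt 1 (sub_le y b)) < length (sub_le y b)"
        unfolding sub_gt_def by (rule length_filter_less) simp
      then show False
        using * comm full by simp
    qed
    have "length (sub_le y b) \<le> length b"
      by (simp add: sub_le_def)
    then have "y < n"
      using full len a(2) by linarith
    obtain s t where st: "s < length b" "t < length b" "b ! s = Unbar y" "b ! t = Bar y"
      using y by (auto simp: both_signs_def in_set_conv_nth)
    note count = length_sub_le_between[OF qb sb st \<open>y < n\<close>]
    obtain y' where y': "a ! s = Unbar y'" "y' \<le> y"
      using small[OF st(1,3)] by blast
    define A where "A = {z. z \<le> y' \<and> Unbar z \<in> set a}"
    define B where "B = {z. z \<le> y \<and> Bar z \<in> set b}"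
    have cards: "card A = Suc s" "card B = length b - t"
      using card_unbarred_upto[OF qa sa _ y'(1)] card_barred_upto[OF qb sb st(2,4)] st len y' \<open>y < n\<close>
      by (auto simp: A_def B_def)
    have "Suc 1 \<le> z" if "Unbar z \<in> set a \<or> Bar z \<in> set b" for z
    proof -
      have "z \<noteq> 1" "1 \<le> z"
        using that a(3) \<open>Bar 1 \<notin> set b\<close> sa sb by (auto simp: alphabet_def)
      then show ?thesis
        by simp
    qed
    then have sub: "A \<subseteq> {Suc 1..y}" "B \<subseteq> {Suc 1..y}"
      using y'(2) by (auto simp: A_def B_def)
    \<comment> \<open>The range \<open>{Suc 1..y}\<close> has only \<open>y - 1\<close> elements.\<close>
    have "y - 1 < card A + card B"
      using cards full count by simp
    then obtain x where x: "x \<in> A" "x \<in> B"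
      and le: "card {z \<in> A. z \<le> x} + card {z \<in> B. z \<le> x} \<le> Suc (x - 1)"
      using least_common_element[OF sub] by blast
    have xy: "2 \<le> x" "x \<le> y'" "x \<le> y"
      using x sub by (auto simp: A_def)
    obtain r where r: "r < length a" "a ! r = Unbar x"
      using x(1) by (auto simp: A_def in_set_conv_nth)
    obtain u where u: "u < length b" "b ! u = Bar x"
      using x(2) by (auto simp: B_def in_set_conv_nth)
    have "{z \<in> A. z \<le> x} = {z. z \<le> x \<and> Unbar z \<in> set a}"
      "{z \<in> B. z \<le> x} = {z. z \<le> x \<and> Bar z \<in> set b}"
      using xy by (auto simp: A_def B_def)
    then have ru: "card {z \<in> A. z \<le> x} = Suc r" "card {z \<in> B. z \<le> x} = length b - u"
      using card_unbarred_upto[OF qa sa r] card_barred_upto[OF qb sb u] xy \<open>y < n\<close> by auto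
    have "finite A" "finite B"
      using sub finite_subset by blast+
    then have "card {z \<in> A. z \<le> x} \<le> card A" "card {z \<in> B. z \<le> x} \<le> card B"
      by (auto intro: card_mono)
    then have order: "r \<le> s" "t \<le> u"
      using ru cards u(1) st(2) by auto
    have "inner_condition n a b x (Suc r) (Suc u)"
      using adj xy order count(1) \<open>y < n\<close> u r by (intro adjacent_inner_condition) auto
    moreover have "x \<le> y \<and> y \<le> n - 1 \<and> Suc r \<le> Suc s \<and> Suc s < Suc t \<and> Suc t \<le> Suc u \<and>
        ((ltr b (Suc s), ltr b (Suc t)) = (Unbar y, Bar y) \<or>
         (ltr a (Suc s), ltr a (Suc t)) = (Unbar y, Bar y))"
      using xy order count(1) \<open>y < n\<close> st by (simp add: ltr_def)
    ultimately have "(Suc s - Suc r) + (Suc u - Suc t) < y - x"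
      unfolding inner_condition_def by blast
    then show False
      using le ru full count order xy u(1) by simp
  qed
  ultimately show ?thesis
    using b a(2) len by (simp add: DII_column_def)
qed

section \<open>Signs of columns of maximal length\<close>

lemma middle_alternate:
  assumes a: "quasi_increasing m a" "set a \<subseteq> alphabet m"
    and ij: "i \<le> j" "j < length a" "rank m (a ! i) = m" "rank m (a ! j) = m"
  shows "a ! i = a ! j \<longleftrightarrow> even (j - i)"
  using ij
proof (induction j rule: dec_induct)
  case (step j)
  have al: "a ! k \<in> alphabet m" if "k < length a" for k
    using a(2) that nth_mem by blast
  have j: "rank m (a ! j) = m"
    using quasi_increasing_rank[OF a, of i j] quasi_increasing_rank[OF a, of j "Suc j"] step
    by (cases "i = j") auto
  have "qless m (a ! j) (a ! Suc j)"
    using successively_nth[OF a(1)[unfolded quasi_increasing_iff]] step.prems by blast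
  then have "a ! j \<noteq> a ! Suc j"
    using prec_iff_rank[OF al al, of j "Suc j"] step.prems j by (auto simp: qless_def mixed_pairs_def)
  moreover have "a ! j \<in> {Unbar m, Bar m}" "a ! Suc j \<in> {Unbar m, Bar m}" "a ! i \<in> {Unbar m, Bar m}"
    using middle_iff_rank al step j by (metis Suc_lessD order_le_less_trans)+
  ultimately have "a ! i = a ! Suc j \<longleftrightarrow> a ! i \<noteq> a ! j"
    by auto
  then show ?case
    using step j by (simp add: Suc_diff_le)
qed simp

text \<open>By the alternation of \<open>Unbar m\<close> and \<open>Bar m\<close>, every occurrence of one of them gives the same sign.\<close>

lemma word_sign_middle:
  assumes a: "quasi_increasing m a" "set a \<subseteq> alphabet m"
    and i: "i < length a" "a ! i \<in> {Unbar m, Bar m}"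
  shows "word_sign m a = (if a ! i = Unbar m \<longleftrightarrow> even (Suc i + m) then 1 else - 1)"
proof -
  have parity: "r mod 2 = m mod 2 \<longleftrightarrow> even (r + m)" for r :: nat
    by presburger
  have al: "a ! k \<in> alphabet m" if "k < length a" for k
    using a(2) that nth_mem by blast
  have indep: "(a ! j = Unbar m \<longleftrightarrow> even (Suc j + m)) \<longleftrightarrow> (a ! k = Unbar m \<longleftrightarrow> even (Suc k + m))"
    if "j \<le> k" "k < length a" "a ! j \<in> {Unbar m, Bar m}" "a ! k \<in> {Unbar m, Bar m}" for j k
  proof -
    have "rank m (a ! j) = m" "rank m (a ! k) = m"
      using that middle_iff_rank[OF al, of j] middle_iff_rank[OF al, of k] by auto
    then have "a ! j = a ! k \<longleftrightarrow> even (k - j)"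
      using middle_alternate[OF a that(1,2)] by simp
    moreover have "even (k - j) \<longleftrightarrow> (even (Suc j + m) \<longleftrightarrow> even (Suc k + m))"
      using that(1) by presburger
    ultimately show ?thesis
      using that(3,4) by auto
  qed
  have sign: "(a ! j = Unbar m \<longleftrightarrow> even (Suc j + m)) \<longleftrightarrow> (a ! i = Unbar m \<longleftrightarrow> even (Suc i + m))"
    if "j < length a" "a ! j \<in> {Unbar m, Bar m}" for j
  proof (cases "i \<le> j")
    case True
    then show ?thesis
      using indep[OF True that(1) i(2) that(2)] by argo
  next
    case False
    then show ?thesis
      using indep[OF _ i(1) that(2) i(2)] by simp
  qed
  have ex: "(\<exists>r\<in>{1..length a}. Q r) \<longleftrightarrow> (\<exists>j<length a. Q (Suc j))" for Q
  proof -
    have "{1..length a} = Suc ` {..<length a}"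
      by (simp add: image_Suc_lessThan)
    then show ?thesis
      by auto
  qed
  have split: "(a ! j = Unbar m \<and> even (Suc j + m) \<or> a ! j = Bar m \<and> odd (Suc j + m)) \<longleftrightarrow>
      a ! j \<in> {Unbar m, Bar m} \<and> (a ! j = Unbar m \<longleftrightarrow> even (Suc j + m))"
    "(a ! j = Unbar m \<and> odd (Suc j + m) \<or> a ! j = Bar m \<and> even (Suc j + m)) \<longleftrightarrow>
      a ! j \<in> {Unbar m, Bar m} \<and> \<not> (a ! j = Unbar m \<longleftrightarrow> even (Suc j + m))" for j
    by auto
  have ex_middle: "(\<exists>j<length a. a ! j \<in> {Unbar m, Bar m} \<and> P (a ! j = Unbar m \<longleftrightarrow> even (Suc j + m))) \<longleftrightarrow>
      P (a ! i = Unbar m \<longleftrightarrow> even (Suc i + m))" for P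
  proof -
    have "P (a ! j = Unbar m \<longleftrightarrow> even (Suc j + m)) \<longleftrightarrow> P (a ! i = Unbar m \<longleftrightarrow> even (Suc i + m))"
      if "j < length a" "a ! j \<in> {Unbar m, Bar m}" for j
      by (rule arg_cong[OF sign[OF that]])
    then show ?thesis
      using i by blast
  qed
  show ?thesis
    unfolding word_sign_def parity ex ltr_def diff_Suc_1 split ex_middle[of "\<lambda>p. p"] ex_middle[of Not]
    by (cases "even i"; cases "even m") simp_all
qed

text \<open>Let \<open>y\<close> be the largest number occurring with both signs (or \<open>0\<close>). By the KN condition at most \<open>y\<close>
  letters are \<open>\<le> y\<close>, while the letters beyond \<open>y\<close> have different absolute values. A column
  avoiding \<open>Unbar m\<close> and \<open>Bar m\<close> therefore has at most \<open>y + (m - 1 - y)\<close> letters.\<close>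

lemma full_column_middle:
  assumes w: "KN_column m w" "length w = m" and m: "1 \<le> m"
  shows "\<exists>i<m. w ! i \<in> {Unbar m, Bar m}"
proof (rule ccontr)
  assume no: "\<not> ?thesis"
  have q: "quasi_increasing m w" and sw: "set w \<subseteq> alphabet m"
    using w by (auto simp: KN_column_def)
  have no_middle: "x \<notin> {Unbar m, Bar m}" if "x \<in> set w" for x
    using no that w(2) by (auto simp: in_set_conv_nth)
  then have abs: "1 \<le> letter_abs x \<and> letter_abs x < m" if "x \<in> set w" for x
    using sw that by (cases x) (force simp: alphabet_def)+
  have "distinct w"
    unfolding distinct_conv_nth
  proof (intro allI impI)
    have "w ! i \<noteq> w ! j" if "i < j" "j < length w" for i j
    proof -
      have "rank m (w ! j) \<noteq> m"
        using no_middle[OF nth_mem] middle_iff_rank[OF subsetD[OF sw nth_mem]] that by blast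
      then show ?thesis
        using quasi_increasing_rank[OF q sw that] by auto
    qed
    then show "w ! i \<noteq> w ! j" if "i < length w" "j < length w" "i \<noteq> j" for i j
      using that by (metis nat_neq_iff)
  qed
  define y where "y = Max (insert 0 (both_signs m w))"
  have fin: "finite (both_signs m w)"
    by (simp add: both_signs_def)
  then have y_in: "y = 0 \<or> y \<in> both_signs m w" and y_max: "\<And>z. z \<in> both_signs m w \<Longrightarrow> z \<le> y"
    using Max_in[of "insert 0 (both_signs m w)"] by (auto simp: y_def)
  have "y < m"
    using y_in m abs[of "Unbar y"] by (auto simp: both_signs_def)
  have "length (sub_le y w) \<le> y"
  proof (cases "y = 0")
    case True
    then have "sub_le y w = []"
      using abs by (force simp: sub_le_def filter_empty_conv)
    then show ?thesis
      by simp
  qed (use y_in w in \<open>auto simp: KN_column_def\<close>)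
  moreover have "length (sub_gt y w) \<le> m - 1 - y"
  proof -
    have inj: "inj_on letter_abs (set (sub_gt y w))"
    proof (rule inj_onI, rule ccontr)
      fix p q assume pq: "p \<in> set (sub_gt y w)" "q \<in> set (sub_gt y w)" "letter_abs p = letter_abs q" "p \<noteq> q"
      define k where "k = letter_abs p"
      have k: "p \<in> set w" "q \<in> set w" "y < k"
        using pq(1,2) unfolding sub_gt_def k_def by auto
      have "{p, q} = {Unbar k, Bar k}"
        using pq(3,4) by (cases p; cases q) (auto simp: k_def)
      then have "k \<in> both_signs m w"
        using k abs[of p] k_def unfolding both_signs_def by fastforce
      then show False
        using y_max k(3) by fastforce
    qed
    have "length (sub_gt y w) = card (letter_abs ` set (sub_gt y w))"
      using card_image[OF inj] distinct_card[of "sub_gt y w"] \<open>distinct w\<close>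
      by (simp add: sub_gt_def distinct_filter)
    also have "\<dots> \<le> card {Suc y..m - 1}"
      using abs by (intro card_mono) (force simp: sub_gt_def)+
    finally show ?thesis
      by simp
  qed
  moreover have "length (sub_le y w) + length (sub_gt y w) = length w"
    using sum_length_filter_compl[of "\<lambda>c. letter_abs c \<le> y" w] by (simp add: sub_le_def sub_gt_def not_le)
  ultimately show False
    using w(2) \<open>y < m\<close> by linarith
qed

text \<open>Let \<open>t\<close> be the first place in \<open>a\<close>, and \<open>s\<close> the last place in \<open>b\<close>, of a letter \<open>Unbar m\<close> or \<open>Bar m\<close>;
  adjacency excludes \<open>t < s\<close>. If \<open>s = t\<close>, these letters lie in one row and agree, being comparable.
  If \<open>s < t\<close>, then \<open>a\<close> has an unbarred letter below \<open>m\<close> in every place before \<open>t\<close> and \<open>b\<close> a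
  barred one in every place after \<open>s\<close>, which are at least \<open>m\<close> letters with absolute value below \<open>m\<close>.
  The least common one would be too far from its barred partner if the signs were opposite: for
  opposite signs the letters in the places \<open>s\<close> and \<open>t\<close> are of the kind that the last two adjacency
  conditions restrict.\<close>

lemma full_columns_same_sign:
  assumes a: "KN_column m a" "length a = m" and b: "KN_column m b" "length b = m"
    and adj: "adjacent m a b" and m: "1 \<le> m"
  shows "word_sign m a = word_sign m b"
proof -
  have qa: "quasi_increasing m a" and sa: "set a \<subseteq> alphabet m"
    and qb: "quasi_increasing m b" and sb: "set b \<subseteq> alphabet m"
    using a(1) b(1) by (auto simp: KN_column_def)
  have ala: "a ! i \<in> alphabet m" and alb: "b ! i \<in> alphabet m" if "i < m" for i
    using sa sb that a b nth_mem[of i a] nth_mem[of i b] by auto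
  define Ma where "Ma = {i. i < m \<and> a ! i \<in> {Unbar m, Bar m}}"
  define Mb where "Mb = {i. i < m \<and> b ! i \<in> {Unbar m, Bar m}}"
  have fin: "finite Ma" "finite Mb" and ne: "Ma \<noteq> {}" "Mb \<noteq> {}"
    using full_column_middle[OF a m] full_column_middle[OF b m] by (auto simp: Ma_def Mb_def)
  define t where "t = Min Ma"
  define s where "s = Max Mb"
  have t: "t \<in> Ma" and t_min: "\<And>i. i \<in> Ma \<Longrightarrow> t \<le> i"
    using fin ne by (auto simp: t_def)
  have s: "s \<in> Mb" and s_max: "\<And>i. i \<in> Mb \<Longrightarrow> i \<le> s"
    using fin ne by (auto simp: s_def)
  have tm: "t < m" "a ! t \<in> {Unbar m, Bar m}" "rank m (a ! t) = m"
    using t middle_iff_rank[OF ala, of t] by (auto simp: Ma_def)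
  have sm: "s < m" "b ! s \<in> {Unbar m, Bar m}" "rank m (b ! s) = m"
    using s middle_iff_rank[OF alb, of s] by (auto simp: Mb_def)
  have "\<not> t < s"
  proof
    assume "t < s"
    then have "1 \<le> Suc t \<and> Suc t < Suc s \<and> Suc s \<le> length b"
      using sm b by simp
    then have "\<not> (ltr a (Suc t) \<in> {Unbar m, Bar m} \<and> ltr b (Suc s) \<in> {Unbar m, Bar m})"
      using adj unfolding adjacent_iff by blast
    then show False
      using tm(2) sm(2) by (auto simp: ltr_def)
  qed
  then consider "s = t" | "s < t"
    by linarith
  then have "(a ! t = Unbar m \<longleftrightarrow> even (Suc t + m)) \<longleftrightarrow> (b ! s = Unbar m \<longleftrightarrow> even (Suc s + m))"
  proof cases
    case 1
    then show ?thesis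
      using preceq_rank[OF adjacent_nth_preceq[OF adj] ala alb, of t] tm sm b by simp
  next
    case 2
    show ?thesis
    proof (rule ccontr)
      assume opposite: "\<not> ?thesis"
      have "t - 1 \<notin> Ma" "Suc s \<notin> Mb"
        using t_min[of "t - 1"] s_max[of "Suc s"] 2 by auto
      then have "rank m (a ! (t - 1)) < m" "m < rank m (b ! Suc s)"
        using quasi_increasing_rank[OF qa sa, of "t - 1" t] quasi_increasing_rank[OF qb sb, of s "Suc s"]
          2 tm sm a b middle_iff_rank[OF ala, of "t - 1"] middle_iff_rank[OF alb, of "Suc s"]
        by (auto simp: Ma_def Mb_def)
      moreover have "t - 1 < m" "Suc s < m"
        using 2 tm by linarith+
      ultimately obtain y z where y: "a ! (t - 1) = Unbar y" "y < m" and z: "b ! Suc s = Bar z" "z < m"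
        using rank_less_middleE[OF ala[of "t - 1"]] rank_greater_middleE[OF alb[of "Suc s"]] by metis
      define A where "A = {w. w \<le> y \<and> Unbar w \<in> set a}"
      define B where "B = {w. w \<le> z \<and> Bar w \<in> set b}"
      have cards: "card A = t" "card B = m - Suc s"
        using card_unbarred_upto[OF qa sa _ y] card_barred_upto[OF qb sb _ z] 2 tm a b
        by (auto simp: A_def B_def)
      have sub: "A \<subseteq> {Suc 0..m - 1}" "B \<subseteq> {Suc 0..m - 1}"
        using y z sa sb by (auto simp: A_def B_def alphabet_def)
      have "m - 1 - 0 < card A + card B"
        using cards 2 tm by linarith
      then obtain x where x: "x \<in> A" "x \<in> B"
        and le: "card {w \<in> A. w \<le> x} + card {w \<in> B. w \<le> x} \<le> Suc (x - 0)"
        using least_common_element[OF sub] by blast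
      have xy: "1 \<le> x" "x \<le> y" "x \<le> z"
        using x sub by (auto simp: A_def B_def)
      obtain r where r: "r < length a" "a ! r = Unbar x"
        using x(1) by (auto simp: A_def in_set_conv_nth)
      obtain u where u: "u < length b" "b ! u = Bar x"
        using x(2) by (auto simp: B_def in_set_conv_nth)
      have "{w \<in> A. w \<le> x} = {w. w \<le> x \<and> Unbar w \<in> set a}"
        "{w \<in> B. w \<le> x} = {w. w \<le> x \<and> Bar w \<in> set b}"
        using xy by (auto simp: A_def B_def)
      then have ru: "card {w \<in> A. w \<le> x} = Suc r" "card {w \<in> B. w \<le> x} = m - u"
        using card_unbarred_upto[OF qa sa r] card_barred_upto[OF qb sb u] xy y z b by auto
      \<comment> \<open>At most \<open>m - 1 - x\<close> elements of \<open>S\<close> exceed \<open>x\<close>; this puts \<open>r\<close> before \<open>s\<close> and \<open>u\<close> after \<open>t\<close>.\<close>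
      have rest: "card S \<le> card {w \<in> S. w \<le> x} + (m - 1 - x)" if "S \<subseteq> {Suc 0..m - 1}" for S
      proof -
        have "card S \<le> card ({w \<in> S. w \<le> x} \<union> {Suc x..m - 1})"
          using that finite_subset[OF that] by (intro card_mono) auto
        also have "\<dots> \<le> card {w \<in> S. w \<le> x} + card {Suc x..m - 1}"
          by (rule card_Un_le)
        finally show ?thesis
          by simp
      qed
      have order: "r \<le> s" "t \<le> u" "m - x \<le> u - r"
        using rest[OF sub(1)] rest[OF sub(2)] le ru cards 2 tm u b xy y by auto
      have "inner_condition m a b x (Suc r) (Suc u)"
        using adj xy y order 2 u r b by (intro adjacent_inner_condition) auto
      moreover have "Suc r \<le> Suc s \<and> Suc s < Suc t \<and> Suc t \<le> Suc u \<and>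
        (odd (Suc t - Suc s + 1) \<and> (ltr b (Suc s), ltr a (Suc t)) \<in> mixed_pairs m \<or>
         even (Suc t - Suc s + 1) \<and> (ltr b (Suc s), ltr a (Suc t)) \<in> same_pairs m)"
      proof -
        have "even (Suc t - Suc s + 1) \<longleftrightarrow> (even (Suc t + m) \<longleftrightarrow> odd (Suc s + m))"
          using 2 by presburger
        then show ?thesis
          using opposite order 2 tm sm by (auto simp: ltr_def mixed_pairs_def same_pairs_def)
      qed
      ultimately have "Suc u - Suc r < m - x"
        unfolding inner_condition_def by blast
      then show False
        using order by simp
    qed
  qed
  then show ?thesis
    using word_sign_middle[OF qa sa, of t] word_sign_middle[OF qb sb, of s] tm sm a b by simp
qed

section \<open>Conjugate partitions\<close>

definition is_partition :: "int list \<Rightarrow> bool" where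
  "is_partition p \<longleftrightarrow> sorted_wrt (\<ge>) p \<and> (\<forall>x\<in>set p. 0 \<le> x)"

lemma is_partition_snoc: "sorted_wrt (\<ge>) (xs @ [x]) \<Longrightarrow> 0 \<le> x \<Longrightarrow> is_partition (xs @ [x])"
  by (force simp: is_partition_def sorted_wrt_append)

lemma is_partition_nonneg: "is_partition p \<Longrightarrow> 0 \<le> nth_default 0 p i"
  by (auto simp: is_partition_def nth_default_def)

lemma is_partition_antimono:
  assumes "is_partition p" "i \<le> j" "j < length p"
  shows "p ! j \<le> p ! i"
  using assms sorted_wrt_nth_less[of "(\<ge>)" p i j] by (cases "i = j") (auto simp: is_partition_def)

lemma less_card_initial_segment:
  fixes S :: "nat set"
  assumes "finite S" and down: "\<And>i j. j \<in> S \<Longrightarrow> i < j \<Longrightarrow> i \<in> S"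
  shows "i < card S \<longleftrightarrow> i \<in> S"
proof -
  obtain k where k: "k \<notin> S"
    using ex_new_if_finite[OF infinite_UNIV_nat assms(1)] by blast
  define l where "l = (LEAST k. k \<notin> S)"
  have "l \<notin> S"
    unfolding l_def using k by (rule LeastI)
  moreover have "i \<in> S" if "i < l" for i
    using not_less_Least[OF that[unfolded l_def]] by simp
  ultimately have "S = {..<l}"
    using down by (metis lessThan_iff linorder_neqE_nat subsetI subset_antisym)
  then show ?thesis
    by simp
qed

text \<open>Both sides say that the diagram of \<open>p\<close> contains the box in row \<open>i\<close> and column \<open>j\<close>, counted from
  \<open>0\<close>. Padding with zeros makes this true for all \<open>i\<close> and \<open>j\<close>.\<close>

lemma conj_part_galois:
  assumes p: "is_partition p"
  shows "i < nth_default 0 (conj_part p) j \<longleftrightarrow> int j < nth_default 0 p i"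
proof -
  let ?S = "{i. i < length p \<and> int (Suc j) \<le> p ! i}"
  have S: "i < card ?S \<longleftrightarrow> i \<in> ?S"
  proof (rule less_card_initial_segment)
    fix i j assume "j \<in> ?S" "i < j"
    then show "i \<in> ?S"
      using is_partition_antimono[OF p, of i j] by auto
  qed simp
  show ?thesis
  proof (cases "j < nat (hd p)")
    case True
    then have "nth_default 0 (conj_part p) j = card ?S"
      by (simp add: conj_part_def nth_default_def del: upt_Suc of_nat_Suc)
    then have "i < nth_default 0 (conj_part p) j \<longleftrightarrow> i \<in> ?S"
      using S by (simp only:)
    then show ?thesis
      by (auto simp: nth_default_def[of 0 p])
  next
    case False
    have "nth_default 0 p i \<le> int j"
    proof (cases "i < length p")
      case True
      then have "p ! i \<le> hd p"
        using is_partition_antimono[OF p, of 0 i] by (cases p) auto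
      then show ?thesis
        using False True by (simp add: nth_default_def)
    qed (simp add: nth_default_def)
    then show ?thesis
      using False by (simp add: conj_part_def nth_default_def del: upt_Suc)
  qed
qed

lemma conj_part_pos:
  assumes "is_partition p" "p \<noteq> []" "x \<in> set (conj_part p)"
  shows "0 < x"
proof -
  obtain j where j: "j < length (conj_part p)" "x = conj_part p ! j"
    using assms(3) by (auto simp: in_set_conv_nth)
  have "int j < nth_default 0 p 0"
    using j(1) assms(2) by (simp add: conj_part_def nth_default_def hd_conv_nth del: upt_Suc)
  then show ?thesis
    using conj_part_galois[OF assms(1), of 0 j] j by (simp add: nth_default_def)
qed

lemma conj_part_le:
  assumes "is_partition p" "nth_default 0 p m = 0" "x \<in> set (conj_part p)"
  shows "x \<le> m"
proof -
  obtain j where j: "j < length (conj_part p)" "x = conj_part p ! j"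
    using assms(3) by (auto simp: in_set_conv_nth)
  then show ?thesis
    using conj_part_galois[OF assms(1), of m j] assms(2) by (simp add: nth_default_def)
qed

lemma sorted_conj_part:
  assumes "is_partition p"
  shows "sorted_wrt (\<ge>) (conj_part p)"
  unfolding sorted_wrt_iff_nth_less
proof (intro allI impI)
  fix i j assume ij: "i < j" "j < length (conj_part p)"
  have "x < nth_default 0 (conj_part p) i" if "x < nth_default 0 (conj_part p) j" for x
    using that ij unfolding conj_part_galois[OF assms] by linarith
  then have "nth_default 0 (conj_part p) j \<le> nth_default 0 (conj_part p) i"
    using not_le by blast
  then show "conj_part p ! j \<le> conj_part p ! i"
    using ij by (simp add: nth_default_def)
qed

lemma int_le_iff_all_nat_less:
  fixes a b :: int
  assumes "0 \<le> b"
  shows "a \<le> b \<longleftrightarrow> (\<forall>j::nat. int j < a \<longrightarrow> int j < b)"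
proof
  assume *: "\<forall>j::nat. int j < a \<longrightarrow> int j < b"
  show "a \<le> b"
    using *[rule_format, of "nat b"] assms by linarith
qed auto

lemma nat_eq_if_all_less: "(\<And>i. i < x \<longleftrightarrow> i < y) \<Longrightarrow> x = (y :: nat)"
  by (metis less_irrefl linorder_neqE_nat)

lemma conj_part_inj:
  assumes p: "is_partition p" and q: "is_partition q" and "length p = length q" "conj_part p = conj_part q"
  shows "p = q"
proof (rule nth_equalityI)
  fix i assume "i < length p"
  have "int j < nth_default 0 p i \<longleftrightarrow> int j < nth_default 0 q i" for j
    using conj_part_galois[OF p] conj_part_galois[OF q] assms(4) by metis
  then have "nth_default 0 p i \<le> nth_default 0 q i" "nth_default 0 q i \<le> nth_default 0 p i"
    by (simp_all add: int_le_iff_all_nat_less is_partition_nonneg p q)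
  then show "p ! i = q ! i"
    using \<open>i < length p\<close> assms(3) by (simp add: nth_default_def)
qed fact

lemma nth_default_eq_imp_eq:
  assumes "\<And>j. nth_default 0 xs j = nth_default 0 ys j" "\<forall>x\<in>set xs. x \<noteq> (0 :: nat)" "\<forall>y\<in>set ys. y \<noteq> 0"
  shows "xs = ys"
proof (rule nth_equalityI)
  have len: "j < length xs \<longleftrightarrow> nth_default 0 xs j \<noteq> 0" "j < length ys \<longleftrightarrow> nth_default 0 ys j \<noteq> 0" for j
    using assms(2,3) by (auto simp: nth_default_def)
  then show "length xs = length ys"
    using assms(1) by (intro nat_eq_if_all_less) auto
  then show "xs ! i = ys ! i" if "i < length xs" for i
    using that assms(1)[of i] by (simp add: nth_default_def)
qed

text \<open>The preimage is the conjugate of \<open>M\<close>, padded with zeros to length \<open>m\<close>.\<close>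

lemma conj_part_surj:
  assumes M: "sorted_wrt (\<ge>) M" "\<And>x. x \<in> set M \<Longrightarrow> 0 < x \<and> x \<le> m" and m: "1 \<le> m"
  obtains p where "is_partition p" "length p = m" "conj_part p = M"
proof -
  define f where "f i = card {j. j < length M \<and> i < M ! j}" for i
  define p where "p = map (\<lambda>i. int (f i)) [0..<m]"
  have f: "j < f i \<longleftrightarrow> j < length M \<and> i < M ! j" for i j
  proof -
    have "j < f i \<longleftrightarrow> j \<in> {j. j < length M \<and> i < M ! j}"
      unfolding f_def
    proof (rule less_card_initial_segment)
      fix j k assume "k \<in> {j. j < length M \<and> i < M ! j}" "j < k"
      then show "j \<in> {j. j < length M \<and> i < M ! j}"
        using sorted_wrt_nth_less[OF M(1), of j k] by auto
    qed simp
    then show ?thesis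
      by simp
  qed
  have "f k \<le> f i" if "i \<le> k" for i k
    using f[of "f i" k] f[of "f i" i] that by fastforce
  then have p: "is_partition p"
    by (auto simp: is_partition_def p_def sorted_wrt_iff_nth_less)
  have "nth_default 0 (conj_part p) j = nth_default 0 M j" for j
  proof (rule nat_eq_if_all_less)
    fix i
    have "int j < nth_default 0 p i \<longleftrightarrow> i < m \<and> j < f i"
      by (auto simp: p_def nth_default_def)
    also have "\<dots> \<longleftrightarrow> i < nth_default 0 M j"
      using M(2)[OF nth_mem, of j] by (auto simp: f nth_default_def)
    finally show "i < nth_default 0 (conj_part p) j \<longleftrightarrow> i < nth_default 0 M j"
      using conj_part_galois[OF p] by simp
  qed
  moreover have "p \<noteq> []"
    using m by (simp add: p_def)
  ultimately have "conj_part p = M"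
    using conj_part_pos[OF p] M(2) by (intro nth_default_eq_imp_eq) fastforce+
  then show ?thesis
    using that p by (simp add: p_def)
qed

text \<open>The interlacing of the rows and the bound on the columns are the same conditions on boxes: every
  box of \<open>q\<close> is in \<open>p\<close>, and every box of \<open>p\<close> which is not in the first row lies directly below a box of \<open>q\<close>.\<close>

lemma horizontal_strip_iff_conj_part:
  assumes p: "is_partition p" and q: "is_partition q"
  shows "horizontal_strip p q \<longleftrightarrow>
    (\<forall>j. nth_default 0 (conj_part q) j \<le> nth_default 0 (conj_part p) j \<and>
         nth_default 0 (conj_part p) j \<le> Suc (nth_default 0 (conj_part q) j))"
proof -
  have le: "x \<le> y \<longleftrightarrow> (\<forall>i. i < x \<longrightarrow> i < y)" for x y :: nat
    by (auto dest!: spec[of _ y])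
  have le_Suc: "x \<le> Suc y \<longleftrightarrow> (\<forall>i. Suc i < x \<longrightarrow> i < y)" for x y :: nat
    by (auto dest!: spec[of _ y])
  show ?thesis
    unfolding horizontal_strip_def le_Suc
    unfolding le conj_part_galois[OF p] conj_part_galois[OF q]
      int_le_iff_all_nat_less[OF is_partition_nonneg[OF p]] int_le_iff_all_nat_less[OF is_partition_nonneg[OF q]]
    by blast
qed

section \<open>Tableaux\<close>

definition DII_tableaux :: "nat \<Rightarrow> nat list \<Rightarrow> tableau set" where
  "DII_tableaux n L = {T. (\<forall>a\<in>set T. DII_column n a) \<and> successively (adjacent n) T \<and> map length T = L}"

text \<open>The union of the sets of tableaux on the right-hand side of the theorem, for \<open>L\<close> the conjugate of \<open>\<nu>\<close>,
  described without weights; the padding with \<open>0\<close> allows for columns that are lost in the reduction.\<close>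

definition strip_tableaux :: "nat \<Rightarrow> nat list \<Rightarrow> tableau set" where
  "strip_tableaux m L = {U. (\<forall>w\<in>set U. KN_column m w) \<and> successively (adjacent m) U \<and> [] \<notin> set U \<and>
     (\<forall>j. nth_default 0 (map length U) j \<le> nth_default 0 L j \<and>
          nth_default 0 L j \<le> Suc (nth_default 0 (map length U) j))}"

text \<open>Having fewer than \<open>n\<close> nonzero entries, \<open>\<nu> @ [0]\<close> prescribes no column of length \<open>n\<close>, so the
  condition on signs is void. The DII property spreads from the first column to all others.\<close>

lemma KNT_DII_eq:
  assumes "length \<nu> < n" and p: "is_partition (\<nu> @ [0])"
  shows "KNT_DII n \<nu> = DII_tableaux n (conj_part (\<nu> @ [0]))"
proof -
  let ?L = "conj_part (\<nu> @ [0])"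
  have par: "par (embed_odd \<nu>) = \<nu> @ [0]"
    by (simp add: par_def embed_odd_def)
  have L: "x < n" if "x \<in> set ?L" for x
    using conj_part_le[OF p _ that, of "length \<nu>"] assms(1) by (simp add: nth_default_def nth_append)
  have short: "length a < n" if "a \<in> set T" "map length T = ?L" for a :: word and T
    using L[of "length a"] that by (metis imageI list.set_map)
  have propagate: "\<forall>a\<in>set T. DII_column n a"
    if "T \<noteq> [] \<longrightarrow> DII_column n (hd T)" "successively (adjacent n) T" "\<forall>a\<in>set T. KN_column n a" for T
    using that
  proof (induction T)
    case (Cons a T)
    have "DII_column n (hd T)" if "T \<noteq> []"
    proof (rule DII_column_adjacent)
      show "KN_column n a" "length a < n" "Unbar 1 \<notin> set a"
        using Cons.prems(1) by (simp_all add: DII_column_def)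
      show "adjacent n a (hd T)" "KN_column n (hd T)"
        using Cons.prems(2,3) that by (simp_all add: successively_Cons)
    qed
    then have "\<forall>a\<in>set T. DII_column n a"
      using Cons.prems(2,3) by (intro Cons.IH) (auto simp: successively_Cons)
    then show ?case
      using Cons.prems(1) by simp
  qed simp
  show ?thesis
  proof (intro equalityI subsetI)
    fix T assume T: "T \<in> KNT_DII n \<nu>"
    then have "\<forall>a\<in>set T. DII_column n a"
      by (intro propagate) (auto simp: KNT_DII_def KNT_def)
    then show "T \<in> DII_tableaux n ?L"
      using T by (simp add: KNT_DII_def KNT_def DII_tableaux_def par)
  next
    fix T assume T: "T \<in> DII_tableaux n ?L"
    then have "length a \<noteq> n" if "a \<in> set T" for a
      using short[OF that] by (auto simp: DII_tableaux_def)
    then show "T \<in> KNT_DII n \<nu>"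
      using T by (auto simp: KNT_DII_def KNT_def DII_tableaux_def par DII_column_def)
  qed
qed

lemma reduce_DII_column:
  assumes a: "DII_column (Suc m) a" and m: "1 \<le> m"
  shows "KN_column m (reduce_column a)"
    and "raise_column (length (reduce_column a) < length a) (reduce_column a) = a"
    and "length (reduce_column a) \<le> length a \<and> length a \<le> Suc (length (reduce_column a))"
proof -
  have q: "quasi_increasing (Suc m) a" "set a \<subseteq> alphabet (Suc m)" "Unbar 1 \<notin> set a"
    using a by (auto simp: DII_column_def KN_column_def)
  note raise = raise_reduce_column[OF q(1,2) m q(3)]
  have "length a = length (reduce_column a) + of_bool (Bar 1 \<in> set a)"
    using raise(1) length_raise_column by metis
  then show "raise_column (length (reduce_column a) < length a) (reduce_column a) = a"
    "length (reduce_column a) \<le> length a \<and> length a \<le> Suc (length (reduce_column a))"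
    using raise(1) by auto
  then show "KN_column m (reduce_column a)"
    using DII_raise_column_iff[OF raise(2) m] a by metis
qed

lemma KN_column_alphabet: "KN_column m w \<Longrightarrow> set w \<subseteq> alphabet m"
  by (simp add: KN_column_def)

text \<open>Once a column is empty all later ones are, so that discarding the empty columns is undone by
  padding to the original length.\<close>

lemma trailing_empty:
  assumes "successively (\<lambda>w v. w = [] \<longrightarrow> v = []) W"
  shows "filter (\<lambda>w. w \<noteq> []) W @ replicate (length W - length (filter (\<lambda>w. w \<noteq> []) W)) [] = W"
  using assms
proof (induction W)
  case (Cons w W)
  show ?case
  proof (cases "w = []")
    case True
    have "W = replicate (length W) []"
      using Cons.prems True
    proof (induction W arbitrary: w)
      case (Cons v W)
      then show ?case
        by (auto simp: successively_Cons)
    qed simp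
    then have "filter (\<lambda>w. w \<noteq> []) W = []"
      by (metis (mono_tags, lifting) filter_False in_set_replicate)
    then show ?thesis
      using True \<open>W = replicate (length W) []\<close> by simp
  next
    case False
    then show ?thesis
      using Cons by (auto simp: successively_Cons)
  qed
qed simp

lemma nth_default_pad: "nth_default 0 (map length (U @ replicate k [])) j = nth_default 0 (map length U) j"
  by (simp add: nth_default_def nth_append)

text \<open>The letter \<open>Bar 1\<close> is appended to the columns that are shorter than prescribed by \<open>L\<close>, including
  the empty columns that the reduction has discarded.\<close>

definition unreduce :: "nat list \<Rightarrow> tableau \<Rightarrow> tableau" where
  "unreduce L U =
     map2 (\<lambda>l w. raise_column (length w < l) w) L (U @ replicate (length L - length U) [])"

lemma reduce_DII_tableaux:
  assumes m: "1 \<le> m" and T: "T \<in> DII_tableaux (Suc m) L"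
  shows "reduce T \<in> strip_tableaux m L" and "unreduce L (reduce T) = T"
proof -
  have DII: "DII_column (Suc m) a" if "a \<in> set T" for a
    using T that by (simp add: DII_tableaux_def)
  have L: "L = map length T"
    using T by (simp add: DII_tableaux_def)
  define W where "W = map reduce_column T"
  have red: "reduce T = filter (\<lambda>w. w \<noteq> []) W"
    by (simp add: reduce_def W_def)
  have step: "successively (\<lambda>a b. reduce_column b \<noteq> [] \<longrightarrow> adjacent m (reduce_column a) (reduce_column b)) T"
  proof (rule successively_mono)
    show "successively (adjacent (Suc m)) T"
      using T by (simp add: DII_tableaux_def)
    fix a b assume ab: "a \<in> set T" "b \<in> set T" "adjacent (Suc m) a b"
    note a = reduce_DII_column[OF DII[OF ab(1)] m] and b = reduce_DII_column[OF DII[OF ab(2)] m]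
    show "reduce_column b \<noteq> [] \<longrightarrow> adjacent m (reduce_column a) (reduce_column b)"
      using adjacent_raise_column_iff[OF KN_column_alphabet[OF a(1)] KN_column_alphabet[OF b(1)] m]
        ab(3) a(2) b(2) by metis
  qed
  then have chain: "successively (\<lambda>w v. v \<noteq> [] \<longrightarrow> adjacent m w v) W"
    by (simp add: W_def successively_map)
  then have "successively (\<lambda>w v. w = [] \<longrightarrow> v = []) W"
    by (rule successively_mono) (auto simp: adjacent_iff)
  then have pad: "reduce T @ replicate (length L - length (reduce T)) [] = W"
    using trailing_empty[of W] by (simp add: red L) (simp add: W_def)
  show "unreduce L (reduce T) = T"
    unfolding unreduce_def pad unfolding W_def L map2_map_map
    using reduce_DII_column(2)[OF DII m] by (simp add: map_idI)
  have "successively (\<lambda>w v. v \<noteq> [] \<longrightarrow> adjacent m w v) (reduce T)"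
    using chain unfolding pad[symmetric] by (simp add: successively_append_iff)
  then have "successively (adjacent m) (reduce T)"
    by (rule successively_mono) (simp add: red)
  moreover have "KN_column m w" if "w \<in> set (reduce T)" for w
    using that reduce_DII_column(1)[OF DII m] by (auto simp: red W_def)
  moreover have "nth_default 0 (map length W) j \<le> nth_default 0 L j \<and>
      nth_default 0 L j \<le> Suc (nth_default 0 (map length W) j)" for j
    using reduce_DII_column(3)[OF DII[OF nth_mem] m, of j] by (auto simp: L W_def nth_default_def)
  then have "nth_default 0 (map length (reduce T)) j \<le> nth_default 0 L j \<and>
      nth_default 0 L j \<le> Suc (nth_default 0 (map length (reduce T)) j)" for j
    unfolding pad[symmetric] nth_default_pad by blast
  ultimately show "reduce T \<in> strip_tableaux m L"
    by (simp add: strip_tableaux_def) (simp add: red)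
qed

lemma unreduce_strip_tableaux:
  assumes m: "1 \<le> m" and L: "sorted_wrt (\<ge>) L" "\<And>x. x \<in> set L \<Longrightarrow> 0 < x \<and> x \<le> m"
    and U: "U \<in> strip_tableaux m L"
  shows "unreduce L U \<in> DII_tableaux (Suc m) L" and "reduce (unreduce L U) = U"
proof -
  define W where "W = U @ replicate (length L - length U) []"
  have ne: "[] \<notin> set U"
    using U by (simp add: strip_tableaux_def)
  have "length U \<le> length L"
  proof (rule ccontr)
    assume *: "\<not> length U \<le> length L"
    then have "length (U ! length L) \<le> nth_default 0 L (length L)"
      using U by (auto simp: strip_tableaux_def nth_default_def dest!: spec[of _ "length L"])
    moreover have "U ! length L \<in> set U"
      using * by simp
    ultimately show False
      using ne by (simp add: nth_default_def)
  qed
  then have lenW: "length W = length L"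
    by (simp add: W_def)
  have KN: "KN_column m w" if "w \<in> set W" for w
  proof -
    have "KN_column m []"
      by (simp add: KN_column_def both_signs_def quasi_increasing_def)
    then show ?thesis
      using that U by (auto simp: W_def strip_tableaux_def)
  qed
  have len: "length (W ! j) \<le> L ! j \<and> L ! j \<le> Suc (length (W ! j))" if "j < length L" for j
  proof -
    have "nth_default 0 (map length W) j \<le> nth_default 0 L j \<and>
      nth_default 0 L j \<le> Suc (nth_default 0 (map length W) j)"
      using U unfolding W_def nth_default_pad by (simp add: strip_tableaux_def)
    then show ?thesis
      using that lenW by (simp add: nth_default_def)
  qed
  let ?c = "\<lambda>j. length (W ! j) < L ! j"
  define T where "T = unreduce L U"
  have lenT: "length T = length L"
    using lenW by (simp add: T_def unreduce_def W_def)
  have T: "T ! j = raise_column (?c j) (W ! j)" if "j < length L" for j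
    using that lenW by (simp add: T_def unreduce_def flip: W_def)
  have lenTj: "length (T ! j) = L ! j" if "j < length L" for j
    using len[OF that] by (auto simp: T that)
  have alph: "set (W ! j) \<subseteq> alphabet m" if "j < length L" for j
    using that lenW by (intro KN_column_alphabet KN) simp
  have pos: "0 < L ! j \<and> L ! j \<le> m" if "j < length L" for j
    using L(2) that by simp
  have "DII_column (Suc m) a" if a: "a \<in> set T" for a
  proof -
    obtain j where j: "j < length L" "a = T ! j"
      using a lenT by (auto simp: in_set_conv_nth)
    then show ?thesis
      using DII_raise_column_iff[OF alph[OF j(1)] m, of "?c j"] KN[of "W ! j"] lenTj[OF j(1)] pos[OF j(1)] lenW
      by (simp add: T)
  qed
  moreover have "map length T = L"
    using lenT lenTj by (intro nth_equalityI) auto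
  moreover have "successively (adjacent (Suc m)) T"
    unfolding successively_conv_nth
  proof (intro allI impI)
    fix j assume "Suc j < length T"
    then have j: "j < length L" "Suc j < length L"
      using lenT by auto
    have "adjacent m (W ! j) (W ! Suc j)" if "W ! Suc j \<noteq> []"
    proof -
      have "Suc j < length U"
        using that j lenW by (auto simp: W_def nth_append split: if_splits)
      then show ?thesis
        using U successively_nth[of "adjacent m" U j] by (simp add: strip_tableaux_def W_def nth_append)
    qed
    moreover have "L ! Suc j \<le> L ! j"
      using sorted_wrt_nth_less[OF L(1), of j "Suc j"] j by simp
    moreover have "T ! Suc j \<noteq> []"
      using lenTj[OF j(2)] pos[OF j(2)] by auto
    ultimately show "adjacent (Suc m) (T ! j) (T ! Suc j)"
      using adjacent_raise_column_iff[OF alph[OF j(1)] alph[OF j(2)] m, of "?c j" "?c (Suc j)"]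
        lenTj[OF j(1)] lenTj[OF j(2)] unfolding T[OF j(1)] T[OF j(2)] by simp
  qed
  ultimately show "unreduce L U \<in> DII_tableaux (Suc m) L"
    by (simp add: DII_tableaux_def T_def)
  have "map reduce_column T = W"
    using lenT lenW by (intro nth_equalityI) (simp_all add: T reduce_raise_column[OF alph])
  then have "reduce T = filter (\<lambda>w. w \<noteq> []) W"
    by (simp add: reduce_def)
  also have "\<dots> = U"
    using ne by (auto simp: W_def filter_id_conv)
  finally show "reduce (unreduce L U) = U"
    by (simp add: T_def)
qed

lemma bij_betw_reduce:
  assumes "1 \<le> m" "sorted_wrt (\<ge>) L" "\<And>x. x \<in> set L \<Longrightarrow> 0 < x \<and> x \<le> m"
  shows "bij_betw reduce (DII_tableaux (Suc m) L) (strip_tableaux m L)"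
  using reduce_DII_tableaux[OF assms(1)] unreduce_strip_tableaux[OF assms]
  by (intro bij_betw_byWitness[where f' = "unreduce L"]) auto

lemma length_par: "length \<mu> = m \<Longrightarrow> 1 \<le> m \<Longrightarrow> length (par \<mu>) = m"
  by (simp add: par_def)

lemma X_even_is_partition: "\<mu> \<in> X_even m \<Longrightarrow> is_partition (par \<mu>)"
  unfolding X_even_def par_def by (intro is_partition_snoc) auto

text \<open>The columns of length \<open>m\<close> come first, and neighbours among them have the same sign. The sign \<open>1\<close>
  is an arbitrary choice if there are none.\<close>

lemma KN_tableau_sign:
  assumes m: "1 \<le> m" and U: "\<forall>w\<in>set U. KN_column m w" "successively (adjacent m) U"
  obtains e :: int where "e \<in> {1, - 1}" "\<And>w. w \<in> set U \<Longrightarrow> length w = m \<Longrightarrow> word_sign m w = e"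
proof -
  let ?R = "\<lambda>a b. length b = m \<longrightarrow> length a = m \<and> word_sign m a = word_sign m b"
  have "successively ?R U"
  proof (rule successively_mono[OF U(2)])
    fix a b assume ab: "a \<in> set U" "b \<in> set U" "adjacent m a b"
    have "length a \<le> m"
      using U(1) ab(1) by (simp add: KN_column_def)
    moreover have "length b \<le> length a"
      using ab(3) by (simp add: adjacent_iff)
    ultimately show "?R a b"
      using full_columns_same_sign[OF _ _ _ _ ab(3) m] U(1) ab(1,2) by auto
  qed
  moreover have "transp ?R"
    by (auto simp: transp_def)
  ultimately have R: "sorted_wrt ?R U"
    by (simp add: successively_conv_sorted_wrt)
  show ?thesis
  proof (cases "\<exists>w\<in>set U. length w = m")
    case True
    then obtain a U' where a: "U = a # U'"
      by (cases U) auto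
    have same: "length a = m \<and> word_sign m w = word_sign m a" if "w \<in> set U" "length w = m" for w
      using R that by (auto simp: a)
    then have "length a = m"
      using True by blast
    moreover have KNa: "KN_column m a"
      using U(1) a by simp
    ultimately obtain i where "i < length a" "a ! i \<in> {Unbar m, Bar m}"
      using full_column_middle[OF _ _ m] by blast
    then have "word_sign m a \<in> {1, - 1}"
      using word_sign_middle[of m a i] KNa by (simp add: KN_column_def)
    then show ?thesis
      using that same by blast
  next
    case False
    then show ?thesis
      using that[of 1] by auto
  qed
qed

text \<open>From the column lengths of \<open>U\<close> one obtains the partition \<open>q = par \<mu>\<close>, and from the common sign of the
  columns of length \<open>m\<close> the sign of the last entry of \<open>\<mu>\<close>. If there are no such columns, the last entry
  of \<open>q\<close> is \<open>0\<close> and the choice of sign is immaterial.\<close>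

lemma UN_KNT_eq:
  assumes m: "1 \<le> m" and \<nu>: "length \<nu> = m" and p: "is_partition (\<nu> @ [0])"
  shows "(\<Union>\<mu>\<in>strip_weights (Suc m) \<nu>. KNT m \<mu>) = strip_tableaux m (conj_part (\<nu> @ [0]))"
proof -
  have par: "par (embed_odd \<nu>) = \<nu> @ [0]"
    by (simp add: par_def embed_odd_def)
  have weights: "strip_weights (Suc m) \<nu> = {\<mu> \<in> X_even m. horizontal_strip (\<nu> @ [0]) (par \<mu>)}"
    by (auto simp: strip_weights_def par part_subset_def horizontal_strip_def)
  show ?thesis
  proof (intro equalityI subsetI)
    fix U assume "U \<in> (\<Union>\<mu>\<in>strip_weights (Suc m) \<nu>. KNT m \<mu>)"
    then obtain \<mu> where \<mu>: "\<mu> \<in> X_even m" "horizontal_strip (\<nu> @ [0]) (par \<mu>)" and U: "U \<in> KNT m \<mu>"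
      by (auto simp: weights)
    note q = X_even_is_partition[OF \<mu>(1)]
    have "par \<mu> \<noteq> []"
      by (simp add: par_def)
    then have "0 < x" if "x \<in> set (map length U)" for x
      using conj_part_pos[OF q] U that by (simp add: KNT_def del: set_map)
    then have "[] \<notin> set U"
      by fastforce
    then show "U \<in> strip_tableaux m (conj_part (\<nu> @ [0]))"
      using U \<mu>(2) horizontal_strip_iff_conj_part[OF p q] by (simp add: KNT_def strip_tableaux_def)
  next
    fix U assume U: "U \<in> strip_tableaux m (conj_part (\<nu> @ [0]))"
    then have KN: "\<forall>w\<in>set U. KN_column m w" and adj: "successively (adjacent m) U"
      by (auto simp: strip_tableaux_def)
    have "successively (\<ge>) (map length U)"
      unfolding successively_map by (rule successively_mono[OF adj]) (simp add: adjacent_iff)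
    then have sorted: "sorted_wrt (\<ge>) (map length U)"
      by (subst (asm) successively_conv_sorted_wrt) (auto simp: transp_def)
    have "0 < x \<and> x \<le> m" if "x \<in> set (map length U)" for x
      using that U by (auto simp: strip_tableaux_def KN_column_def)
    then obtain q where q: "is_partition q" "length q = m" "conj_part q = map length U"
      using conj_part_surj[OF sorted _ m] by blast
    obtain e :: int where e: "e \<in> {1, - 1}" "\<And>w. w \<in> set U \<Longrightarrow> length w = m \<Longrightarrow> word_sign m w = e"
      using KN_tableau_sign[OF m KN adj] by blast
    have "q \<noteq> []"
      using q(2) m by auto
    define \<mu> where "\<mu> = butlast q @ [e * last q]"
    have "0 \<le> last q"
      using q(1) \<open>q \<noteq> []\<close> by (auto simp: is_partition_def)
    then have "\<bar>e * last q\<bar> = last q"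
      using e(1) by auto
    then have par_\<mu>: "par \<mu> = q"
      using \<open>q \<noteq> []\<close> by (simp add: par_def \<mu>_def)
    have "length \<mu> = m"
      using q(2) m by (simp add: \<mu>_def)
    then have "\<mu> \<in> X_even m"
      using q(1) par_\<mu> by (simp add: X_even_def is_partition_def)
    moreover have "horizontal_strip (\<nu> @ [0]) (par \<mu>)"
      unfolding par_\<mu> horizontal_strip_iff_conj_part[OF p q(1)] q(3)
      using U by (simp add: strip_tableaux_def)
    moreover have "word_sign m w = weight_sign \<mu>" if w: "w \<in> set U" "length w = m" for w
    proof -
      obtain j where j: "j < length U" "w = U ! j"
        using w(1) by (auto simp: in_set_conv_nth)
      \<comment> \<open>A column of length \<open>m\<close> reaches the last row of \<open>q\<close>, whose number counted from \<open>0\<close> is \<open>m - 1\<close>.\<close>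
      then have "m - 1 < nth_default 0 (conj_part q) j"
        using w(2) m by (simp add: q(3) nth_default_def)
      then have "0 < last q"
        using conj_part_galois[OF q(1)] q(2) m \<open>q \<noteq> []\<close>
        by (auto simp: nth_default_def last_conv_nth)
      then show ?thesis
        using e w by (auto simp: weight_sign_def \<mu>_def sgn_mult)
    qed
    ultimately show "U \<in> (\<Union>\<mu>\<in>strip_weights (Suc m) \<nu>. KNT m \<mu>)"
      using KN adj q(3) by (auto simp: weights KNT_def par_\<mu>)
  qed
qed

text \<open>The column lengths of \<open>T\<close> determine \<open>par \<mu>\<close>. If the last entry of \<open>\<mu>\<close> is nonzero, then the first
  column has length \<open>m\<close> and its sign is that of the entry.\<close>

lemma KNT_weight_unique:
  assumes m: "1 \<le> m" and \<mu>: "\<mu> \<in> X_even m" "\<mu>' \<in> X_even m" and T: "T \<in> KNT m \<mu>" "T \<in> KNT m \<mu>'"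
  shows "\<mu> = \<mu>'"
proof -
  have len: "length \<mu> = m" "length \<mu>' = m"
    using \<mu> by (auto simp: X_even_def)
  note q = X_even_is_partition[OF \<mu>(1)]
  have par: "par \<mu> = par \<mu>'"
    using T len m
    by (intro conj_part_inj q X_even_is_partition[OF \<mu>(2)]) (auto simp: length_par KNT_def)
  then have butlast: "butlast \<mu> = butlast \<mu>'" and abs: "\<bar>last \<mu>\<bar> = \<bar>last \<mu>'\<bar>"
    by (auto simp: par_def)
  have "last \<mu> = last \<mu>'"
  proof (cases "last \<mu> = 0")
    case False
    have "nth_default 0 (par \<mu>) (m - 1) = \<bar>last \<mu>\<bar>"
      using len m by (simp add: par_def nth_default_def nth_append)
    then have "m - 1 < nth_default 0 (conj_part (par \<mu>)) 0"
      using False by (simp add: conj_part_galois[OF q])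
    then have "m - 1 < nth_default 0 (map length T) 0"
      using T(1) by (simp add: KNT_def)
    then have ne: "T \<noteq> []" and "m \<le> length (hd T)"
      by (cases T; simp)+
    moreover have "length (hd T) \<le> m"
      using T(1) ne by (auto simp: KNT_def KN_column_def)
    ultimately have "weight_sign \<mu> = weight_sign \<mu>'"
      using T ne by (auto simp: KNT_def dest!: bspec[of _ _ "hd T"])
    then show ?thesis
      using abs by (metis weight_sign_def abs_sgn mult_sgn_abs)
  qed (use abs in simp)
  then show ?thesis
    using butlast len m by (metis append_butlast_last_id list.size(3) not_one_le_zero)
qed

theorem theorem1p5p3:
  fixes n :: nat and \<nu> :: "int list"
  assumes "n \<ge> 2" and "\<nu> \<in> X_odd (n - 1)"
  shows "disjoint_family_on (KNT (n - 1)) (strip_weights n \<nu>) \<and>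
         bij_betw reduce (KNT_DII n \<nu>) (\<Union>\<mu>\<in>strip_weights n \<nu>. KNT (n - 1) \<mu>)"
proof
  define m where "m = n - 1"
  have m: "1 \<le> m" and n: "n = Suc m"
    using assms(1) by (auto simp: m_def)
  have \<nu>: "length \<nu> = m" and p: "is_partition (\<nu> @ [0])"
    using assms(2) by (auto simp: X_odd_def m_def intro: is_partition_snoc)
  show "disjoint_family_on (KNT (n - 1)) (strip_weights n \<nu>)"
    using KNT_weight_unique[OF m] by (auto simp: disjoint_family_on_def strip_weights_def n)
  have "0 < x \<and> x \<le> m" if "x \<in> set (conj_part (\<nu> @ [0]))" for x
    using conj_part_pos[OF p _ that] conj_part_le[OF p _ that, of m] \<nu>
    by (simp add: nth_default_def nth_append)
  then have "bij_betw reduce (DII_tableaux (Suc m) (conj_part (\<nu> @ [0])))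
      (strip_tableaux m (conj_part (\<nu> @ [0])))"
    by (rule bij_betw_reduce[OF m sorted_conj_part[OF p]])
  then show "bij_betw reduce (KNT_DII n \<nu>) (\<Union>\<mu>\<in>strip_weights n \<nu>. KNT (n - 1) \<mu>)"
    using KNT_DII_eq[of \<nu> n, OF _ p] UN_KNT_eq[OF m \<nu> p] \<nu> by (simp add: n)
qed

end
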